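(* Let $q$ be a real parameter and $z$ a real number. If $q$ is an algebraic and irrational number and $z \neq 0$ is algebraic, then $e_q(z)$ is transcendental, where $e_q$ is the Tsallis $q$-exponential.
   Context: For a real parameter $q$ and real $z$, the Tsallis $q$-exponential $e_q^z = e_q(z) = \exp_q(z)$ is defined by: $e_q^z = e^z$ if $q = 1$; $e_q^z = [1+(1-q)z]^{1/(1-q)}$ if $q \neq 1$ and $1+(1-q)z \geq 0$; $e_q^z = 0$ if $q \neq 1$ and $1+(1-q)z < 0$. "Algebraic" and "transcendental" mean over $\mathbb{Q}$.
   Formalization: The formal theorem adds the hypothesis 1+(1-q)z > 0; otherwise e_q(z) is 0, hence algebraic (e.g. q = √2, z = 10), or, when 1+(1-q)z = 0 and q > 1, undefined. *)

theory Defs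
  imports Complex_Main "HOL-Computational_Algebra.Polynomial"
begin

(* The boundary value at 1 + (1 - q) * z = 0 inherits the convention 0 powr a = 0.
   This is the intended value for q < 1; for q > 1 the expression 0 to a negative
   power has no real value, and 0 is only a default. *)
definition tsallis_exp :: "real \<Rightarrow> real \<Rightarrow> real" where
  "tsallis_exp q z =
     (if q = 1 then exp z
      else if 1 + (1 - q) * z \<ge> 0 then (1 + (1 - q) * z) powr (1 / (1 - q))
      else 0)"

end

theory Submission
  imports
    Defs
    "Jordan_Normal_Form.Char_Poly"
    "HOL-Real_Asymp.Real_Asymp"
begin

text \<open>
  The claim is an instance of the Gelfond--Schneider theorem for real numbers: if \<open>\<alpha> > 0\<close>,
  \<open>\<alpha> \<noteq> 1\<close> and \<open>\<beta>\<close> are algebraic and \<open>\<beta>\<close> is irrational, then \<open>\<alpha> powr \<beta>\<close> is transcendental. It is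
  applied to \<open>\<alpha> = 1 + (1 - q) * z\<close> and \<open>\<beta> = 1 / (1 - q)\<close>.

  Gelfond--Schneider is proved by Schneider's method with an interpolation determinant, using
  only real analysis. Put \<open>w = ln \<alpha>\<close> and suppose that \<open>\<gamma> = \<alpha> powr \<beta>\<close> is algebraic. Consider the
  \<open>L = s ^ 4\<close> functions \<open>x ^ t * exp (\<sigma> * w * x)\<close> with \<open>t < s ^ 3\<close> and \<open>\<sigma> < s\<close>, the \<open>L\<close> points
  \<open>i + j * \<beta>\<close> with \<open>i, j < s ^ 2\<close>, which are distinct because \<open>\<beta>\<close> is irrational, and the
  determinant \<open>\<Delta>\<close> of the values of these functions at these points.

  \<^item> \<open>\<Delta> \<noteq> 0\<close>, since by Rolle's theorem a nonzero real exponential polynomial with these frequencies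
    and degrees has fewer than \<open>L\<close> zeros (\<open>exp_poly_eq_0\<close>, \<open>exp_monom_det_nonzero\<close>).

  \<^item> \<open>\<Delta>\<close> is very small: in Newton's interpolation basis the matrix factors into a matrix of divided
    differences and a triangular matrix, and the \<open>m\<close>-th divided difference is an \<open>m\<close>-th derivative
    divided by \<open>m!\<close> (\<open>newton_interpolation\<close>, \<open>abs_interpolation_det_le\<close>). As \<open>s\<close> grows, the logarithm
    of the resulting bound is \<open>- (s ^ 8 / 2) * ln s\<close> up to \<open>O(s ^ 8)\<close>.

  \<^item> \<open>\<Delta>\<close> cannot be too small: its entries are \<open>(i + j * \<beta>) ^ t * \<alpha> ^ (\<sigma> * i) * \<gamma> ^ (\<sigma> * j)\<close>, so
    \<open>\<Delta>\<close> is a polynomial in \<open>\<alpha>\<close>, \<open>\<beta>\<close>, \<open>\<gamma>\<close> with integer coefficients, and Liouville's inequality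
    (\<open>liouville_inequality\<close>) bounds \<open>ln \<bar>\<Delta>\<bar>\<close> below by \<open>- O(s ^ 7 * ln s)\<close>.

  For large \<open>s\<close> the two bounds contradict each other. Heights are measured through integer matrices:
  \<open>\<alpha>\<close>, \<open>\<beta>\<close>, \<open>\<gamma>\<close> act by multiplication on a finite-dimensional \<open>\<rat>\<close>-subspace of \<open>\<real>\<close>, and a multiple of
  each of them acts by an integer matrix in a fixed basis of that space.
\<close>

section \<open>Rolle's theorem and interpolation determinants\<close>

lemma Rolle_card:
  fixes f f' :: "real \<Rightarrow> real"
  assumes deriv: "\<And>x. (f has_real_derivative f' x) (at x)"
    and "finite Z" "card Z = Suc n" "Z \<subseteq> {l..u}" "\<And>z. z \<in> Z \<Longrightarrow> f z = 0"
  shows "\<exists>Z'. finite Z' \<and> card Z' = n \<and> Z' \<subseteq> {l..u} \<and> (\<forall>z\<in>Z'. f' z = 0)"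
proof -
  \<comment> \<open>Because of the half-open interval, the zero of \<open>f'\<close> that Rolle's theorem yields to the right
     of the old maximum differs from the earlier ones.\<close>
  have "\<exists>Z'. finite Z' \<and> Suc (card Z') = card Z \<and> Z' \<subseteq> {Min Z..<Max Z} \<and> (\<forall>z\<in>Z'. f' z = 0)"
    if "finite Z" "Z \<noteq> {}" "\<And>z. z \<in> Z \<Longrightarrow> f z = 0" for Z :: "real set"
    using that
  proof (induction Z rule: finite_linorder_max_induct)
    case empty
    then show ?case by simp
  next
    case (insert b A)
    show ?case
    proof (cases "A = {}")
      case True
      then show ?thesis by (intro exI[of _ "{}"]) auto
    next
      case False
      then obtain Z' where Z': "finite Z'" "Suc (card Z') = card A" "Z' \<subseteq> {Min A..<Max A}"
          "\<forall>z\<in>Z'. f' z = 0"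
        using insert.IH insert.prems by blast
      have MA: "Max A \<in> A" "Min A \<le> Max A" and mb: "Max A < b"
        using insert.hyps False by auto
      have "\<exists>z. Max A < z \<and> z < b \<and> f' z = 0"
      proof -
        have "continuous_on {Max A..b} f"
          by (meson DERIV_isCont continuous_at_imp_continuous_on deriv)
        moreover have "(f has_derivative (\<lambda>h. f' x * h)) (at x)" for x
          using deriv[of x] by (simp add: has_field_derivative_def)
        moreover have "f (Max A) = f b"
          using insert.prems MA by simp
        ultimately obtain z where "Max A < z" "z < b" "(\<lambda>h. f' z * h) = (\<lambda>v. 0)"
          using Rolle_deriv[OF mb, of f "\<lambda>x h. f' x * h"] by blast
        then show ?thesis by (metis mult_cancel_left1)
      qed
      then obtain z where z: "Max A < z" "z < b" "f' z = 0" by blast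
      have "Min A \<le> z" using MA z by simp
      moreover have "z \<notin> Z'" using Z'(3) z by auto
      moreover have "b \<notin> A" using insert.hyps by auto
      moreover have "Max (insert b A) = b" "Min (insert b A) = Min A"
        using insert.hyps False MA mb by simp_all
      moreover have "insert z Z' \<subseteq> {Min A..<b}"
        using Z'(3) z \<open>Min A \<le> z\<close> mb by (auto simp del: Max_less_iff)
      ultimately show ?thesis
        using Z'(1,2,4) z(3) insert.hyps(1)
        by (intro exI[of _ "insert z Z'"]) (simp del: insert_subset)
    qed
  qed
  moreover have ne: "Z \<noteq> {}" using assms(3) by auto
  ultimately obtain Z' where Z': "finite Z'" "Suc (card Z') = card Z"
      "Z' \<subseteq> {Min Z..<Max Z}" "\<forall>z\<in>Z'. f' z = 0"
    using assms(2,5) by meson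
  have "Min Z \<in> Z" "Max Z \<in> Z" using assms(2) ne by auto
  then have "l \<le> Min Z" "Max Z \<le> u" using assms(4) by auto
  then have "Z' \<subseteq> {l..u}" using Z'(3) by auto
  with Z' assms(3) show ?thesis by auto
qed

lemma Rolle_iterated:
  fixes F :: "nat \<Rightarrow> real \<Rightarrow> real"
  assumes "\<And>k x. (F k has_real_derivative F (Suc k) x) (at x)"
    and "finite Z" "card Z = k + n" "Z \<subseteq> {l..u}" "\<And>z. z \<in> Z \<Longrightarrow> F 0 z = 0"
  shows "\<exists>Z'. finite Z' \<and> card Z' = n \<and> Z' \<subseteq> {l..u} \<and> (\<forall>z\<in>Z'. F k z = 0)"
  using assms(3)
proof (induction k arbitrary: n)
  case 0
  then show ?case using assms by auto
next
  case (Suc k)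
  from Suc.IH[of "Suc n"] Suc.prems obtain Z' where "finite Z'" "card Z' = Suc n"
      "Z' \<subseteq> {l..u}" "\<forall>z\<in>Z'. F k z = 0" by auto
  then show ?case
    using Rolle_card[of "F k" "F (Suc k)" Z' n l u, OF assms(1)] by simp
qed

text \<open>
  The Newton basis polynomial \<open>(t - x 0) * \<dots> * (t - x (m - 1))\<close> for the nodes \<open>x\<close>.
\<close>
definition newton_poly :: "(nat \<Rightarrow> real) \<Rightarrow> nat \<Rightarrow> real poly" where
  "newton_poly x m = (\<Prod>l<m. [:- x l, 1:])"

lemma poly_newton_poly: "poly (newton_poly x m) t = (\<Prod>l<m. t - x l)"
  by (simp add: newton_poly_def poly_prod)

lemma degree_newton_poly: "degree (newton_poly x m) = m"
  and lead_newton_poly: "coeff (newton_poly x m) m = 1"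
proof -
  show d: "degree (newton_poly x m) = m"
    by (simp add: newton_poly_def degree_prod_eq_sum_degree)
  have "lead_coeff (newton_poly x m) = 1"
    by (simp add: newton_poly_def lead_coeff_prod)
  then show "coeff (newton_poly x m) m = 1" using d by simp
qed

lemma higher_pderiv_degree_le:
  fixes p :: "real poly"
  assumes "degree p \<le> n"
  shows "(pderiv ^^ n) p = [:fact n * coeff p n:]"
proof (rule poly_eqI)
  fix i
  show "coeff ((pderiv ^^ n) p) i = coeff [:fact n * coeff p n:] i"
    using assms by (cases i) (auto simp: coeff_higher_pderiv pochhammer_fact coeff_eq_0)
qed

text \<open>
  Newton interpolation with the mean value form of the coefficients (the divided differences);
  \<open>f k\<close> is the \<open>k\<close>-th derivative of \<open>f 0\<close>. The coefficient \<open>c m\<close> depends on the first \<open>m + 1\<close>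
  nodes only. Subtracting the interpolating polynomial of these nodes from \<open>f 0\<close> leaves a function
  with \<open>m + 1\<close> zeros, whose \<open>m\<close>-th derivative \<open>f m - fact m * c m\<close> therefore has a zero.
\<close>
lemma newton_interpolation:
  fixes f :: "nat \<Rightarrow> real \<Rightarrow> real" and x :: "nat \<Rightarrow> real"
  assumes deriv: "\<And>k t. (f k has_real_derivative f (Suc k) t) (at t)"
    and inj: "inj_on x {..<L}" and sub: "x ` {..<L} \<subseteq> {l..u}"
  shows "\<exists>c. (\<forall>j<L. f 0 (x j) = (\<Sum>m<L. c m * (\<Prod>l<m. x j - x l))) \<and>
             (\<forall>m<L. \<exists>\<xi>\<in>{l..u}. c m = f m \<xi> / fact m)"
  using inj sub
proof (induction L)
  case 0
  then show ?case by simp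
next
  case (Suc L)
  then obtain c where c: "\<forall>j<L. f 0 (x j) = (\<Sum>m<L. c m * (\<Prod>l<m. x j - x l))"
      "\<forall>m<L. \<exists>\<xi>\<in>{l..u}. c m = f m \<xi> / fact m"
    by (auto simp: lessThan_Suc)
  define W where "W j = (\<Prod>l<L. x j - x l)" for j
  define d where "d = (f 0 (x L) - (\<Sum>m<L. c m * (\<Prod>l<m. x L - x l))) / W L"
  define c' where "c' = c(L := d)"
  have WL: "W L \<noteq> 0"
    using inj_onD[OF Suc.prems(1), of L] by (fastforce simp: W_def)
  have W0: "W j = 0" if "j < L" for j using that by (auto simp: W_def)
  have interp: "f 0 (x j) = (\<Sum>m<Suc L. c' m * (\<Prod>l<m. x j - x l))" if "j < Suc L" for j
  proof -
    have "(\<Sum>m<Suc L. c' m * (\<Prod>l<m. x j - x l)) = (\<Sum>m<L. c m * (\<Prod>l<m. x j - x l)) + d * W j"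
      by (simp add: c'_def W_def)
    also have "\<dots> = f 0 (x j)"
    proof (cases "j = L")
      case True
      then show ?thesis using WL by (simp add: d_def)
    next
      case False
      then show ?thesis using that c(1) W0 by auto
    qed
    finally show ?thesis by simp
  qed
  define P where "P = (\<Sum>m<Suc L. Polynomial.smult (c' m) (newton_poly x m))"
  have polyP: "poly P t = (\<Sum>m<Suc L. c' m * (\<Prod>l<m. t - x l))" for t
    by (simp add: P_def poly_sum poly_newton_poly)
  have degP: "degree P \<le> L"
    unfolding P_def by (rule degree_sum_le) (auto intro: order.trans[OF degree_smult_le] simp: degree_newton_poly)
  have coeffP: "coeff P L = d"
    by (simp add: P_def coeff_sum c'_def lead_newton_poly coeff_eq_0 degree_newton_poly)
  define F where "F k t = f k t - poly ((pderiv ^^ k) P) t" for k t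
  have dF: "(F k has_real_derivative F (Suc k) t) (at t)" for k t
    unfolding F_def by (auto intro!: derivative_eq_intros deriv poly_DERIV)
  have "card (x ` {..<Suc L}) = L + 1"
    using Suc.prems(1) by (simp add: card_image)
  moreover have "F 0 z = 0" if "z \<in> x ` {..<Suc L}" for z
    using that interp by (auto simp: F_def polyP simp del: sum.lessThan_Suc)
  ultimately obtain Z' where "card Z' = 1" "Z' \<subseteq> {l..u}" "\<forall>z\<in>Z'. F L z = 0"
    using Rolle_iterated[of F "x ` {..<Suc L}" L 1 l u] dF Suc.prems(2) by blast
  then obtain \<xi> where "\<xi> \<in> {l..u}" "F L \<xi> = 0"
    by (auto simp: card_Suc_eq)
  then have xi: "\<xi> \<in> {l..u}" "c' L = f L \<xi> / fact L"
    using higher_pderiv_degree_le[OF degP] coeffP by (auto simp: F_def c'_def)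
  have "\<exists>\<xi>\<in>{l..u}. c' m = f m \<xi> / fact m" if "m < Suc L" for m
    using that xi c(2) by (cases "m = L") (auto simp: c'_def)
  with interp show ?case by blast
qed

lemma abs_det_le:
  fixes A :: "real mat"
  assumes A: "A \<in> carrier_mat n n"
    and b: "\<And>i j. i < n \<Longrightarrow> j < n \<Longrightarrow> \<bar>A $$ (i, j)\<bar> \<le> b j"
  shows "\<bar>det A\<bar> \<le> fact n * (\<Prod>j<n. b j)"
proof -
  let ?P = "{p. p permutes {0..<n}}"
  have "\<bar>det A\<bar> \<le> (\<Sum>p\<in>?P. \<bar>signof p * (\<Prod>i = 0..<n. A $$ (i, p i))\<bar>)"
    unfolding det_def'[OF A] by (rule sum_abs)
  also have "\<dots> \<le> (\<Sum>p\<in>?P. \<Prod>j<n. b j)"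
  proof (rule sum_mono)
    fix p assume p: "p \<in> ?P"
    have "\<bar>signof p * (\<Prod>i = 0..<n. A $$ (i, p i))\<bar> = (\<Prod>i = 0..<n. \<bar>A $$ (i, p i)\<bar>)"
      by (simp add: abs_mult abs_prod sign_def)
    also have "\<dots> \<le> (\<Prod>i = 0..<n. b (p i))"
      using p by (intro prod_mono) (auto intro!: b simp: permutes_in_image)
    also have "\<dots> = (\<Prod>j = 0..<n. b j)"
      using p by (simp add: prod.permute[of p "{0..<n}" b, simplified comp_def])
    finally show "\<bar>signof p * (\<Prod>i = 0..<n. A $$ (i, p i))\<bar> \<le> (\<Prod>j<n. b j)"
      by (simp add: lessThan_atLeast0)
  qed
  also have "\<dots> = fact n * (\<Prod>j<n. b j)"
    by (simp add: card_permutations)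
  finally show ?thesis .
qed

text \<open>
  The upper bound for interpolation determinants. The gain over the trivial estimate is the product
  of the factorials in the denominator, of size about \<open>L powr (L\<^sup>2 / 2)\<close>.
\<close>
lemma abs_interpolation_det_le:
  fixes f :: "nat \<Rightarrow> nat \<Rightarrow> real \<Rightarrow> real" and x :: "nat \<Rightarrow> real"
  assumes deriv: "\<And>i k t. i < L \<Longrightarrow> (f i k has_real_derivative f i (Suc k) t) (at t)"
    and inj: "inj_on x {..<L}" and sub: "x ` {..<L} \<subseteq> {- X..X}"
    and bound: "\<And>i k t. i < L \<Longrightarrow> t \<in> {- X..X} \<Longrightarrow> \<bar>f i k t\<bar> \<le> C * R ^ k"
  shows "\<bar>det (mat L L (\<lambda>(i, j). f i 0 (x j)))\<bar> \<le> fact L * C ^ L * (\<Prod>m<L. (2 * X * R) ^ m / fact m)"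
proof -
  have "\<exists>c. (\<forall>j<L. f i 0 (x j) = (\<Sum>m<L. c m * (\<Prod>l<m. x j - x l))) \<and>
             (\<forall>m<L. \<exists>\<xi>\<in>{- X..X}. c m = f i m \<xi> / fact m)" if "i < L" for i
    by (rule newton_interpolation[of "f i" x L "- X" X]) (use deriv that inj sub in auto)
  then obtain c where c: "\<And>i j. i < L \<Longrightarrow> j < L \<Longrightarrow> f i 0 (x j) = (\<Sum>m<L. c i m * (\<Prod>l<m. x j - x l))"
     "\<And>i m. i < L \<Longrightarrow> m < L \<Longrightarrow> \<exists>\<xi>\<in>{- X..X}. c i m = f i m \<xi> / fact m"
    by metis
  define G where "G = mat L L (\<lambda>(i, m). c i m)"
  define N where "N = mat L L (\<lambda>(m, j). \<Prod>l<m. x j - x l)"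
  have car: "G \<in> carrier_mat L L" "N \<in> carrier_mat L L" by (simp_all add: G_def N_def)
  \<comment> \<open>The products in \<open>N\<close> vanish for \<open>j < m\<close>, so the sums in Newton's formula may run over all \<open>m < L\<close>.\<close>
  have GN: "mat L L (\<lambda>(i, j). f i 0 (x j)) = G * N"
    by (rule eq_matI) (auto simp: G_def N_def c(1) scalar_prod_def lessThan_atLeast0)
  have detN: "det N = (\<Prod>j<L. \<Prod>l<j. x j - x l)"
  proof -
    have "upper_triangular N" by (rule upper_triangularI) (auto simp: N_def)
    from det_upper_triangular[OF this car(2)] show ?thesis
      by (simp add: prod_list_diag_prod N_def lessThan_atLeast0)
  qed
  have "\<bar>det G\<bar> \<le> fact L * (\<Prod>m<L. C * R ^ m / fact m)"
  proof (rule abs_det_le[OF car(1)])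
    fix i m assume "i < L" "m < L"
    with c(2) obtain \<xi> where "\<xi> \<in> {- X..X}" "c i m = f i m \<xi> / fact m" by blast
    with bound[of i \<xi> m] \<open>i < L\<close> \<open>m < L\<close> show "\<bar>G $$ (i, m)\<bar> \<le> C * R ^ m / fact m"
      by (simp add: G_def divide_right_mono)
  qed
  moreover have "\<bar>det N\<bar> \<le> (\<Prod>m<L. (2 * X) ^ m)"
  proof -
    have "\<bar>det N\<bar> = (\<Prod>j<L. \<Prod>l<j. \<bar>x j - x l\<bar>)" by (simp add: detN abs_prod)
    also have "\<dots> \<le> (\<Prod>j<L. \<Prod>l<j. 2 * X)"
    proof (intro prod_mono conjI prod_nonneg ballI)
      fix j l assume "j \<in> {..<L}" "l \<in> {..<j}"
      then have "j < L" "l < L" by auto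
      then have "x j \<in> {- X..X}" "x l \<in> {- X..X}" using sub by blast+
      then show "\<bar>x j - x l\<bar> \<le> 2 * X" by auto
    qed auto
    finally show ?thesis by simp
  qed
  ultimately have "\<bar>det G\<bar> * \<bar>det N\<bar> \<le> (fact L * (\<Prod>m<L. C * R ^ m / fact m)) * (\<Prod>m<L. (2 * X) ^ m)"
    by (intro mult_mono) (auto intro: order.trans[OF abs_ge_zero])
  also have "\<dots> = fact L * C ^ L * (\<Prod>m<L. (2 * X * R) ^ m / fact m)"
    by (simp add: prod.distrib prod_dividef power_mult_distrib)
  finally show ?thesis by (simp add: GN det_mult[OF car] abs_mult)
qed

section \<open>Exponential polynomials\<close>

text \<open>
  The operator that differentiation induces on the polynomial factor of \<open>p(t) * exp (r * t)\<close>.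
\<close>
definition twisted_deriv :: "real \<Rightarrow> real poly \<Rightarrow> real poly" where
  "twisted_deriv r p = pderiv p + Polynomial.smult r p"

lemma has_derivative_exp_poly:
  "((\<lambda>t. poly p t * exp (r * t)) has_real_derivative poly (twisted_deriv r p) t * exp (r * t)) (at t)"
  by (auto intro!: derivative_eq_intros poly_DERIV simp: twisted_deriv_def algebra_simps)

lemma degree_pderiv_le: "degree (pderiv p) \<le> degree p" for p :: "real poly"
  by (simp add: degree_pderiv)

lemma degree_twisted_deriv_le: "degree (twisted_deriv r p) \<le> degree p"
  unfolding twisted_deriv_def
  by (intro degree_add_le degree_pderiv_le degree_smult_le)

lemma degree_twisted_deriv_funpow_le: "degree ((twisted_deriv r ^^ k) p) \<le> degree p"
  by (induction k) (auto intro: order.trans[OF degree_twisted_deriv_le])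

lemma twisted_deriv_eq_0:
  assumes "twisted_deriv r p = 0" "r \<noteq> 0"
  shows "p = 0"
proof (rule ccontr)
  assume "p \<noteq> 0"
  have "coeff (twisted_deriv r p) (degree p) = r * lead_coeff p"
    by (simp add: twisted_deriv_def coeff_pderiv coeff_eq_0)
  with assms \<open>p \<noteq> 0\<close> show False by simp
qed

lemma twisted_deriv_funpow_eq_0:
  assumes "(twisted_deriv r ^^ k) p = 0" "r \<noteq> 0"
  shows "p = 0"
  using assms by (induction k) (auto dest: twisted_deriv_eq_0)

text \<open>
  Multiplying by \<open>exp (- r S * t)\<close> and differentiating \<open>T\<close> times removes one frequency and, by
  Rolle's theorem, at most \<open>T\<close> zeros, while the other frequencies stay distinct and nonzero.
\<close>
lemma exp_poly_eq_0:
  fixes P :: "nat \<Rightarrow> real poly" and r :: "nat \<Rightarrow> real"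
  assumes "inj_on r {..<S}" "\<And>s. s < S \<Longrightarrow> degree (P s) < T"
    and "finite Z" "card Z = S * T"
    and "\<And>z. z \<in> Z \<Longrightarrow> (\<Sum>s<S. poly (P s) z * exp (r s * z)) = 0"
    and "s < S"
  shows "P s = 0"
  using assms
proof (induction S arbitrary: P r Z s)
  case 0
  then show ?case by simp
next
  case (Suc S)
  define q where "q s = r s - r S" for s
  define F where "F k t = (\<Sum>s<Suc S. poly ((twisted_deriv (q s) ^^ k) (P s)) t * exp (q s * t))" for k t
  have dF: "(F k has_real_derivative F (Suc k) t) (at t)" for k t
    unfolding F_def funpow.simps comp_def
    by (intro derivative_intros has_derivative_exp_poly)
  have qS: "q S = 0" by (simp add: q_def)
  have F0: "F 0 z = 0" if "z \<in> Z" for z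
  proof -
    have "F 0 z = exp (- r S * z) * (\<Sum>s<Suc S. poly (P s) z * exp (r s * z))"
      unfolding F_def sum_distrib_left
      by (intro sum.cong) (auto simp: q_def left_diff_distrib exp_diff exp_minus field_simps)
    with Suc.prems(5)[OF that] show ?thesis by simp
  qed
  have "card Z = T + S * T" using Suc.prems(4) by simp
  then obtain Z' where Z': "finite Z'" "card Z' = S * T" "\<forall>z\<in>Z'. F T z = 0"
    using Rolle_iterated[of F Z T "S * T" "Min Z" "Max Z", OF dF Suc.prems(3)] F0 Suc.prems(3)
    by fastforce
  have "twisted_deriv 0 = pderiv" by (auto simp: twisted_deriv_def)
  moreover have "(pderiv ^^ T) (P S) = 0"
    using Suc.prems(2)[of S] by (intro poly_eqI) (simp add: coeff_higher_pderiv coeff_eq_0)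
  ultimately have FT: "F T z = (\<Sum>s<S. poly ((twisted_deriv (q s) ^^ T) (P s)) z * exp (q s * z))" for z
    by (simp add: F_def qS)
  have low: "P s = 0" if "s < S" for s
  proof (rule twisted_deriv_funpow_eq_0)
    show "q s \<noteq> 0" using inj_onD[OF Suc.prems(1), of s S] that by (auto simp: q_def)
    show "(twisted_deriv (q s) ^^ T) (P s) = 0"
    proof (rule Suc.IH[of q _ Z'])
      show "inj_on q {..<S}"
        using Suc.prems(1) by (auto simp: q_def inj_on_def)
      show "degree ((twisted_deriv (q s) ^^ T) (P s)) < T" if "s < S" for s
        using Suc.prems(2)[of s] degree_twisted_deriv_funpow_le[of T "q s" "P s"] that by simp
    qed (use that Z' FT in auto)
  qed
  have "P S = 0"
  proof (rule ccontr)
    assume "P S \<noteq> 0"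
    have "poly (P S) z = 0" if "z \<in> Z" for z
      using F0[OF that] by (simp add: F_def low qS)
    then have "card Z \<le> card {z. poly (P S) z = 0}"
      by (intro card_mono poly_roots_finite \<open>P S \<noteq> 0\<close>) auto
    also have "\<dots> \<le> degree (P S)" by (rule card_poly_roots_bound[OF \<open>P S \<noteq> 0\<close>])
    also have "\<dots> < T" using Suc.prems(2) by simp
    finally show False using Suc.prems(4) by simp
  qed
  with low Suc.prems(6) show ?case by (cases "s = S") auto
qed

text \<open>
  The sum of the absolute values of the terms of \<open>p\<close> at \<open>X\<close>, for polynomials of degree at most \<open>T\<close>
  (coefficients beyond \<open>T\<close> are ignored). On such polynomials \<open>twisted_deriv r\<close> has operator norm at
  most \<open>T / X + \<bar>r\<bar>\<close>. The factor \<open>1 / X\<close> is essential: \<open>T + \<bar>r\<bar>\<close> would be too large for the final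
  comparison.
\<close>
definition weighted_norm :: "nat \<Rightarrow> real \<Rightarrow> real poly \<Rightarrow> real" where
  "weighted_norm T X p = (\<Sum>i\<le>T. \<bar>coeff p i\<bar> * X ^ i)"

lemma abs_poly_le_weighted_norm:
  assumes "degree p \<le> T" "\<bar>t\<bar> \<le> X"
  shows "\<bar>poly p t\<bar> \<le> weighted_norm T X p"
proof -
  have "poly p t = (\<Sum>i\<le>T. coeff p i * t ^ i)"
    unfolding poly_altdef using assms(1)
    by (intro sum.mono_neutral_left) (auto simp: coeff_eq_0)
  also have "\<bar>\<dots>\<bar> \<le> (\<Sum>i\<le>T. \<bar>coeff p i * t ^ i\<bar>)" by (rule sum_abs)
  also have "\<dots> \<le> weighted_norm T X p"
    unfolding weighted_norm_def using assms(2)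
    by (intro sum_mono) (auto simp: abs_mult power_abs intro!: mult_left_mono power_mono)
  finally show ?thesis .
qed

lemma weighted_norm_twisted_deriv_le:
  assumes "degree p \<le> T" "X > 0"
  shows "weighted_norm T X (twisted_deriv r p) \<le> (T / X + \<bar>r\<bar>) * weighted_norm T X p"
proof -
  have "weighted_norm T X (pderiv p) \<le> T / X * weighted_norm T X p"
  proof -
    have "weighted_norm T X (pderiv p) = (\<Sum>i<T. \<bar>coeff (pderiv p) i\<bar> * X ^ i)"
      unfolding weighted_norm_def using assms(1)
      by (intro sum.mono_neutral_right) (auto simp: coeff_pderiv coeff_eq_0 not_less)
    also have "\<dots> \<le> (\<Sum>i<T. T / X * (\<bar>coeff p (Suc i)\<bar> * X ^ Suc i))"
    proof (rule sum_mono)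
      fix i assume "i \<in> {..<T}"
      then have "real (Suc i) * (\<bar>coeff p (Suc i)\<bar> * X ^ i) \<le> real T * (\<bar>coeff p (Suc i)\<bar> * X ^ i)"
        using assms(2) by (intro mult_right_mono) auto
      then show "\<bar>coeff (pderiv p) i\<bar> * X ^ i \<le> T / X * (\<bar>coeff p (Suc i)\<bar> * X ^ Suc i)"
        using assms(2) by (simp add: coeff_pderiv abs_mult mult.assoc)
    qed
    also have "\<dots> = T / X * (\<Sum>i\<in>Suc ` {..<T}. \<bar>coeff p i\<bar> * X ^ i)"
      by (simp add: sum_distrib_left sum.reindex)
    also have "\<dots> \<le> T / X * weighted_norm T X p"
      unfolding weighted_norm_def using assms(2)
      by (intro mult_left_mono sum_mono2) auto
    finally show ?thesis .
  qed
  moreover have "weighted_norm T X (twisted_deriv r p) \<le> weighted_norm T X (pderiv p) + \<bar>r\<bar> * weighted_norm T X p"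
  proof -
    have "weighted_norm T X (twisted_deriv r p)
        \<le> (\<Sum>i\<le>T. \<bar>coeff (pderiv p) i\<bar> * X ^ i + \<bar>r\<bar> * (\<bar>coeff p i\<bar> * X ^ i))"
      unfolding weighted_norm_def
    proof (rule sum_mono)
      fix i
      have "\<bar>coeff (twisted_deriv r p) i\<bar> \<le> \<bar>coeff (pderiv p) i\<bar> + \<bar>r\<bar> * \<bar>coeff p i\<bar>"
        unfolding twisted_deriv_def coeff_add coeff_smult abs_mult[symmetric] by (rule abs_triangle_ineq)
      from mult_right_mono[OF this, of "X ^ i"] assms(2)
      show "\<bar>coeff (twisted_deriv r p) i\<bar> * X ^ i \<le> \<bar>coeff (pderiv p) i\<bar> * X ^ i + \<bar>r\<bar> * (\<bar>coeff p i\<bar> * X ^ i)"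
        by (simp add: algebra_simps)
    qed
    then show ?thesis by (simp add: weighted_norm_def sum.distrib sum_distrib_left)
  qed
  ultimately show ?thesis by (simp add: algebra_simps)
qed

lemma abs_exp_monom_deriv_le:
  assumes "j \<le> T" "X \<ge> 1" "\<bar>t\<bar> \<le> X"
  shows "\<bar>poly ((twisted_deriv r ^^ k) (monom 1 j)) t * exp (r * t)\<bar>
           \<le> X ^ T * exp (\<bar>r\<bar> * X) * (T / X + \<bar>r\<bar>) ^ k"
proof -
  have deg: "degree ((twisted_deriv r ^^ k) (monom 1 j)) \<le> T" for k
    using degree_twisted_deriv_funpow_le[of k r "monom 1 j"] assms(1) by (simp add: degree_monom_eq)
  have "weighted_norm T X ((twisted_deriv r ^^ k) (monom 1 j)) \<le> (T / X + \<bar>r\<bar>) ^ k * X ^ T"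
  proof (induction k)
    case 0
    have "weighted_norm T X (monom 1 j) = X ^ j"
      using assms(1) by (simp add: weighted_norm_def if_distrib[of abs] if_distrib[of "\<lambda>u. u * _"] cong: if_cong)
    also have "\<dots> \<le> X ^ T" using assms by (intro power_increasing) auto
    finally show ?case by simp
  next
    case (Suc k)
    have "weighted_norm T X ((twisted_deriv r ^^ Suc k) (monom 1 j))
       \<le> (T / X + \<bar>r\<bar>) * weighted_norm T X ((twisted_deriv r ^^ k) (monom 1 j))"
      using weighted_norm_twisted_deriv_le[OF deg] assms(2) by simp
    also have "\<dots> \<le> (T / X + \<bar>r\<bar>) * ((T / X + \<bar>r\<bar>) ^ k * X ^ T)"
      using assms(2) by (intro mult_left_mono Suc.IH) auto
    finally show ?case by (simp add: mult.assoc)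
  qed
  then have 1: "\<bar>poly ((twisted_deriv r ^^ k) (monom 1 j)) t\<bar> \<le> (T / X + \<bar>r\<bar>) ^ k * X ^ T"
    using abs_poly_le_weighted_norm[OF deg assms(3), of k] by linarith
  have "r * t \<le> \<bar>r\<bar> * X"
    using mult_left_mono[OF assms(3), of "\<bar>r\<bar>"] abs_ge_self[of "r * t"] by (simp add: abs_mult)
  then have "exp (r * t) \<le> exp (\<bar>r\<bar> * X)" by simp
  with 1 have "\<bar>poly ((twisted_deriv r ^^ k) (monom 1 j)) t\<bar> * exp (r * t)
      \<le> ((T / X + \<bar>r\<bar>) ^ k * X ^ T) * exp (\<bar>r\<bar> * X)"
    by (intro mult_mono) (use assms(2) in auto)
  then show ?thesis by (simp add: abs_mult mult_ac)
qed

section \<open>Algebraic numbers acting on rational vector spaces\<close>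

text \<open>The real numbers as a vector space over \<open>\<rat>\<close>.\<close>
interpretation rat_real: vector_space "\<lambda>(r::rat) (x::real). of_rat r * x"
  by standard (simp_all add: algebra_simps of_rat_add of_rat_mult)

lemma rat_span_mult_image:
  assumes "\<And>u. u \<in> G \<Longrightarrow> y * u \<in> rat_real.span G'" "w \<in> rat_real.span G"
  shows "y * w \<in> rat_real.span G'"
  using assms(2)
proof (induction rule: rat_real.span_induct_alt)
  case base
  then show ?case by (simp add: rat_real.span_zero)
next
  case (step c u w)
  have "y * (of_rat c * u + w) = of_rat c * (y * u) + y * w" by (simp add: algebra_simps)
  with step assms(1) show ?case by (simp add: rat_real.span_add rat_real.span_scale)
qed

text \<open>
  Adjoining the multiples by \<open>x ^ i\<close> for \<open>i\<close> below the degree of an equation for \<open>x\<close> makes the span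
  closed under multiplication by \<open>x\<close>, and keeps it closed under any multiplication that preserved
  the original span.
\<close>
lemma rat_span_extend_closed:
  assumes "finite G" and "algebraic (x :: real)"
  shows "\<exists>G'. finite G' \<and> G \<subseteq> G' \<and> (\<forall>u\<in>G'. x * u \<in> rat_real.span G') \<and>
           (\<forall>y. (\<forall>u\<in>G. y * u \<in> rat_real.span G) \<longrightarrow> (\<forall>u\<in>G'. y * u \<in> rat_real.span G'))"
proof -
  obtain p where p: "\<And>i. coeff p i \<in> \<rat>" "p \<noteq> 0" "poly p x = 0"
    using assms(2) unfolding algebraic_altdef by blast
  define d where "d = degree p"
  have "d \<noteq> 0"
  proof
    assume "d = 0"
    then obtain c where "p = [:c:]" by (auto simp: d_def elim: degree_eq_zeroE)
    with p show False by simp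
  qed
  define G' where "G' = (\<lambda>(i, u). x ^ i * u) ` ({..<d} \<times> G)"
  have mem: "x ^ i * u \<in> G'" if "i < d" "u \<in> G" for i u
    using that by (force simp: G'_def)
  have "finite G'" using assms(1) by (simp add: G'_def)
  moreover have "G \<subseteq> G'" using mem[of 0] \<open>d \<noteq> 0\<close> by auto
  moreover have "x * w \<in> rat_real.span G'" if w: "w \<in> G'" for w
  proof -
    obtain i u where iu: "i < d" "u \<in> G" "w = x ^ i * u" using w by (auto simp: G'_def)
    show ?thesis
    proof (cases "Suc i < d")
      case True
      with mem[OF True iu(2)] show ?thesis by (simp add: iu(3) rat_real.span_base mult.assoc)
    next
      case False
      with iu have "Suc i = d" by simp
      have "\<forall>i. \<exists>q. coeff p i = of_rat q" using p(1) by (auto elim: Rats_cases)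
      then obtain r where r: "\<And>i. coeff p i = of_rat (r i)" by metis
      have lead: "r d \<noteq> 0" using p(2) r[of d] by (auto simp: d_def)
      have "of_rat (r d) * x ^ d = - (\<Sum>k<d. of_rat (r k) * x ^ k)"
        using p(3) by (simp add: poly_altdef r d_def[symmetric] lessThan_Suc_atMost[symmetric])
      then have "x ^ d = (\<Sum>k<d. of_rat (- r k / r d) * x ^ k)"
        using lead by (simp add: field_simps of_rat_divide of_rat_minus sum_negf sum_divide_distrib[symmetric])
      then have xw: "x * w = (\<Sum>k<d. of_rat (- r k / r d) * (x ^ k * u))"
        unfolding iu(3) mult.assoc[symmetric] sum_distrib_right[symmetric] using \<open>Suc i = d\<close> by auto
      show ?thesis
        unfolding xw by (intro rat_real.span_sum rat_real.span_scale rat_real.span_base mem iu(2)) simp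
    qed
  qed
  moreover have "y * w \<in> rat_real.span G'" if y: "\<forall>u\<in>G. y * u \<in> rat_real.span G" and w: "w \<in> G'" for y w
  proof -
    obtain i u where iu: "i < d" "u \<in> G" "w = x ^ i * u" using w by (auto simp: G'_def)
    have "x ^ i * (y * u) \<in> rat_real.span G'"
      by (rule rat_span_mult_image[of G]) (use mem iu y in \<open>auto intro: rat_real.span_base\<close>)
    then show ?thesis by (simp add: iu(3) mult_ac)
  qed
  ultimately show ?thesis by (intro exI[of _ G'] conjI ballI allI impI) auto
qed

lemma rat_span_closed_exists:
  assumes "finite \<Gamma>" "\<And>g. g \<in> \<Gamma> \<Longrightarrow> algebraic (g :: real)"
  shows "\<exists>G. finite G \<and> 1 \<in> G \<and> (\<forall>g\<in>\<Gamma>. \<forall>u\<in>G. g * u \<in> rat_real.span G)"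
  using assms
proof (induction \<Gamma>)
  case empty
  then show ?case by (intro exI[of _ "{1}"]) simp
next
  case (insert x \<Gamma>)
  then obtain G where G: "finite G" "1 \<in> G" "\<forall>g\<in>\<Gamma>. \<forall>u\<in>G. g * u \<in> rat_real.span G" by auto
  from rat_span_extend_closed[OF G(1), of x] insert.prems obtain G' where
    "finite G'" "G \<subseteq> G'" "\<forall>u\<in>G'. x * u \<in> rat_real.span G'"
    "\<forall>y. (\<forall>u\<in>G. y * u \<in> rat_real.span G) \<longrightarrow> (\<forall>u\<in>G'. y * u \<in> rat_real.span G')" by auto
  with G show ?case by (intro exI[of _ G']) auto
qed

text \<open>
  Finitely many algebraic numbers act by rational matrices on one family \<open>v\<close> that is linearly
  independent over \<open>\<rat>\<close>.
\<close>
lemma algebraic_common_basis: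
  assumes "finite \<Gamma>" "\<And>g. g \<in> \<Gamma> \<Longrightarrow> algebraic (g :: real)"
  obtains n :: nat and v :: "nat \<Rightarrow> real" where "n > 0"
    and "\<And>c :: nat \<Rightarrow> rat. (\<Sum>i<n. of_rat (c i) * v i) = 0 \<Longrightarrow> \<forall>i<n. c i = 0"
    and "\<And>g. g \<in> \<Gamma> \<Longrightarrow> \<exists>A :: nat \<Rightarrow> nat \<Rightarrow> rat. \<forall>i<n. g * v i = (\<Sum>j<n. of_rat (A i j) * v j)"
proof -
  obtain G where G: "finite G" "1 \<in> G" "\<forall>g\<in>\<Gamma>. \<forall>u\<in>G. g * u \<in> rat_real.span G"
    using rat_span_closed_exists[OF assms] by blast
  obtain B where B: "B \<subseteq> G" "rat_real.independent B" "G \<subseteq> rat_real.span B"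
    using rat_real.maximal_independent_subset by blast
  have fin: "finite B" using G(1) B(1) by (rule rev_finite_subset)
  have GB: "rat_real.span G \<subseteq> rat_real.span B"
    using B(3) rat_real.span_minimal rat_real.subspace_span by blast
  have "B \<noteq> {}" using B(3) G(2) by auto
  obtain v where v: "bij_betw v {..<card B} B"
    using ex_bij_betw_nat_finite[OF fin] by (auto simp: lessThan_atLeast0)
  have reindex: "(\<Sum>u\<in>B. f u) = (\<Sum>i<card B. f (v i))" for f :: "real \<Rightarrow> real"
    using sum.reindex_bij_betw[OF v, of f] by simp
  show thesis
  proof (rule that)
    show "card B > 0" using \<open>B \<noteq> {}\<close> fin by (simp add: card_gt_0_iff)
  next
    fix c :: "nat \<Rightarrow> rat"
    assume c: "(\<Sum>i<card B. of_rat (c i) * v i) = 0"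
    define c' where "c' u = c (the_inv_into {..<card B} v u)" for u
    have c': "c' (v i) = c i" if "i < card B" for i
      using that v by (simp add: c'_def bij_betw_def the_inv_into_f_f)
    have "(\<Sum>u\<in>B. of_rat (c' u) * u) = 0"
      using c by (simp add: reindex c')
    then have "c' (v i) = 0" if "i < card B" for i
      using rat_real.independentD[OF B(2) fin subset_refl] that v by (auto simp: bij_betw_def)
    then show "\<forall>i<card B. c i = 0" using c' by auto
  next
    fix g assume "g \<in> \<Gamma>"
    have "\<exists>a :: nat \<Rightarrow> rat. g * v i = (\<Sum>j<card B. of_rat (a j) * v j)" if "i < card B" for i
    proof -
      have "v i \<in> G" using v that B(1) by (auto simp: bij_betw_def)
      then have "g * v i \<in> rat_real.span B" using G(3) GB \<open>g \<in> \<Gamma>\<close> by blast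
      then obtain a where "g * v i = (\<Sum>u\<in>B. of_rat (a u) * u)"
        unfolding rat_real.span_finite[OF fin] by auto
      then show ?thesis by (intro exI[of _ "\<lambda>j. a (v j)"]) (simp add: reindex)
    qed
    then show "\<exists>A :: nat \<Rightarrow> nat \<Rightarrow> rat. \<forall>i<card B. g * v i = (\<Sum>j<card B. of_rat (A i j) * v j)"
      by metis
  qed
qed

lemma algebraic_if_rat_eigenvalue:
  fixes x :: real and A :: "nat \<Rightarrow> nat \<Rightarrow> rat"
  assumes eig: "\<And>i. i < n \<Longrightarrow> x * v i = (\<Sum>j<n. of_rat (A i j) * v j)"
    and "i\<^sub>0 < n" "v i\<^sub>0 \<noteq> 0"
  shows "algebraic x"
proof -
  define M where "M = mat n n (\<lambda>(i, j). A i j)"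
  have M: "M \<in> carrier_mat n n" by (simp add: M_def)
  then have R: "map_mat of_rat M \<in> carrier_mat n n" by simp
  have "eigenvector (map_mat of_rat M) (vec n v) x"
    unfolding eigenvector_def
  proof (intro conjI)
    show "vec n v \<noteq> 0\<^sub>v (dim_row (map_mat of_rat M))"
      using assms(2,3) by (auto simp: vec_eq_iff M_def)
    show "map_mat of_rat M *\<^sub>v vec n v = x \<cdot>\<^sub>v vec n v"
      by (rule eq_vecI) (auto simp: M_def scalar_prod_def eig lessThan_atLeast0)
  qed (simp add: M_def)
  then have "poly (char_poly (map_mat of_rat M)) x = 0"
    using eigenvalue_root_char_poly[OF R] by (auto simp: eigenvalue_def)
  moreover have "char_poly (map_mat of_rat M) = map_poly (of_rat :: rat \<Rightarrow> real) (char_poly M)"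
    by (rule of_rat_hom.char_poly_hom[OF M])
  ultimately show ?thesis
    using degree_monic_char_poly[OF M]
    by (intro algebraicI'[of "map_poly of_rat (char_poly M)"]) (auto simp: coeff_map_poly)
qed

lemma rat_independent_nonzero:
  assumes "\<And>c :: nat \<Rightarrow> rat. (\<Sum>i<n. of_rat (c i) * v i) = 0 \<Longrightarrow> \<forall>i<n. c i = 0" "k < n"
  shows "v k \<noteq> (0 :: real)"
proof
  assume "v k = 0"
  then have "(\<Sum>i<n. of_rat (if i = k then 1 else 0) * v i) = 0"
    by (intro sum.neutral) auto
  from assms(1)[OF this] assms(2) show False by auto
qed

lemma algebraic_add:
  assumes "algebraic (x :: real)" "algebraic y"
  shows "algebraic (x + y)"
proof -
  obtain n v where n: "n > 0" and ind: "\<And>c. (\<Sum>i<n. of_rat (c i) * v i) = 0 \<Longrightarrow> \<forall>i<n. c i = 0"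
    and ops: "\<And>g. g \<in> {x, y} \<Longrightarrow> \<exists>A :: nat \<Rightarrow> nat \<Rightarrow> rat. \<forall>i<n. g * v i = (\<Sum>j<n. of_rat (A i j) * v j)"
    using algebraic_common_basis[of "{x, y}"] assms by auto
  obtain A where A: "\<forall>i<n. x * v i = (\<Sum>j<n. of_rat (A i j) * v j)" using ops[of x] by auto
  obtain B where B: "\<forall>i<n. y * v i = (\<Sum>j<n. of_rat (B i j) * v j)" using ops[of y] by auto
  have v0: "v 0 \<noteq> 0" by (rule rat_independent_nonzero[OF ind n])
  have "(x + y) * v i = (\<Sum>j<n. of_rat (A i j + B i j) * v j)" if "i < n" for i
    using A[rule_format, OF that] B[rule_format, OF that]
    by (simp add: distrib_right of_rat_add sum.distrib)
  then show ?thesis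
    using n v0 by (rule algebraic_if_rat_eigenvalue[where v = v and A = "\<lambda>i j. A i j + B i j"])
qed

lemma algebraic_mult:
  assumes "algebraic (x :: real)" "algebraic y"
  shows "algebraic (x * y)"
proof -
  obtain n v where n: "n > 0" and ind: "\<And>c. (\<Sum>i<n. of_rat (c i) * v i) = 0 \<Longrightarrow> \<forall>i<n. c i = 0"
    and ops: "\<And>g. g \<in> {x, y} \<Longrightarrow> \<exists>A :: nat \<Rightarrow> nat \<Rightarrow> rat. \<forall>i<n. g * v i = (\<Sum>j<n. of_rat (A i j) * v j)"
    using algebraic_common_basis[of "{x, y}"] assms by auto
  obtain A where A: "\<forall>i<n. x * v i = (\<Sum>j<n. of_rat (A i j) * v j)" using ops[of x] by auto
  obtain B where B: "\<forall>i<n. y * v i = (\<Sum>j<n. of_rat (B i j) * v j)" using ops[of y] by auto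
  have v0: "v 0 \<noteq> 0" by (rule rat_independent_nonzero[OF ind n])
  have "x * y * v i = (\<Sum>j<n. of_rat (\<Sum>k<n. B i k * A k j) * v j)" if "i < n" for i
  proof -
    have "x * y * v i = x * (\<Sum>k<n. of_rat (B i k) * v k)"
      using that B by (simp only: mult.assoc)
    also have "\<dots> = (\<Sum>k<n. of_rat (B i k) * (x * v k))"
      by (simp add: sum_distrib_left mult.left_commute)
    also have "\<dots> = (\<Sum>k<n. of_rat (B i k) * (\<Sum>j<n. of_rat (A k j) * v j))"
      using A by (intro sum.cong) auto
    also have "\<dots> = (\<Sum>k<n. \<Sum>j<n. of_rat (B i k * A k j) * v j)"
      by (simp only: sum_distrib_left of_rat_mult mult.assoc)
    also have "\<dots> = (\<Sum>j<n. of_rat (\<Sum>k<n. B i k * A k j) * v j)"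
      by (subst sum.swap) (simp only: of_rat_sum sum_distrib_right)
    finally show ?thesis .
  qed
  then show ?thesis
    using n v0 by (rule algebraic_if_rat_eigenvalue[where v = v and A = "\<lambda>i j. \<Sum>k<n. B i k * A k j"])
qed

section \<open>Heights and Liouville's inequality\<close>

text \<open>
  \<open>height_le n v x H\<close> says that multiplication by \<open>x\<close> acts on \<open>v 0, \<dots>, v (n - 1)\<close> by an integer matrix
  all of whose rows have \<open>\<ell>\<^sub>1\<close>-norm at most \<open>H\<close>. This is a substitute for the usual height of an
  algebraic integer: it is subadditive and submultiplicative.
\<close>
definition height_le :: "nat \<Rightarrow> (nat \<Rightarrow> real) \<Rightarrow> real \<Rightarrow> real \<Rightarrow> bool" where
  "height_le n v x H \<longleftrightarrow> (\<exists>A :: nat \<Rightarrow> nat \<Rightarrow> int. \<forall>i<n.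
     x * v i = (\<Sum>j<n. of_int (A i j) * v j) \<and> (\<Sum>j<n. \<bar>real_of_int (A i j)\<bar>) \<le> H)"

lemma height_le_mono: "height_le n v x H \<Longrightarrow> H \<le> K \<Longrightarrow> height_le n v x K"
  unfolding height_le_def by (meson order.trans)

lemma height_le_of_int: "height_le n v (of_int m) \<bar>of_int m\<bar>"
proof -
  have "(\<Sum>j<n. of_int (if i = j then m else 0) * v j) = of_int m * v i"
    and "(\<Sum>j<n. \<bar>real_of_int (if i = j then m else 0)\<bar>) = \<bar>of_int m\<bar>" if "i < n" for i
    using that by (simp_all add: if_distrib[of of_int] if_distrib[of abs] if_distrib[of "\<lambda>u. u * _"] cong: if_cong)
  then show ?thesis
    unfolding height_le_def by (intro exI[of _ "\<lambda>i j. if i = j then m else 0"]) simp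
qed

lemma height_le_add:
  assumes "height_le n v x H" "height_le n v y K"
  shows "height_le n v (x + y) (H + K)"
proof -
  obtain A where A: "\<And>i. i < n \<Longrightarrow> x * v i = (\<Sum>j<n. of_int (A i j) * v j)"
      "\<And>i. i < n \<Longrightarrow> (\<Sum>j<n. \<bar>real_of_int (A i j)\<bar>) \<le> H"
    using assms(1) unfolding height_le_def by blast
  obtain B where B: "\<And>i. i < n \<Longrightarrow> y * v i = (\<Sum>j<n. of_int (B i j) * v j)"
      "\<And>i. i < n \<Longrightarrow> (\<Sum>j<n. \<bar>real_of_int (B i j)\<bar>) \<le> K"
    using assms(2) unfolding height_le_def by blast
  have "(\<Sum>j<n. \<bar>real_of_int (A i j + B i j)\<bar>) \<le> H + K" if "i < n" for i
  proof -
    have "(\<Sum>j<n. \<bar>real_of_int (A i j + B i j)\<bar>) \<le> (\<Sum>j<n. \<bar>real_of_int (A i j)\<bar> + \<bar>real_of_int (B i j)\<bar>)"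
      by (intro sum_mono) simp
    with A(2)[OF that] B(2)[OF that] show ?thesis by (simp add: sum.distrib)
  qed
  then show ?thesis
    unfolding height_le_def
    by (intro exI[of _ "\<lambda>i j. A i j + B i j"]) (simp add: A(1) B(1) distrib_right sum.distrib)
qed

lemma height_le_mult:
  assumes "height_le n v x H" "height_le n v y K"
  shows "height_le n v (x * y) (H * K)"
proof -
  obtain A where A: "\<And>i. i < n \<Longrightarrow> x * v i = (\<Sum>j<n. of_int (A i j) * v j)"
      "\<And>i. i < n \<Longrightarrow> (\<Sum>j<n. \<bar>real_of_int (A i j)\<bar>) \<le> H"
    using assms(1) unfolding height_le_def by blast
  obtain B where B: "\<And>i. i < n \<Longrightarrow> y * v i = (\<Sum>j<n. of_int (B i j) * v j)"
      "\<And>i. i < n \<Longrightarrow> (\<Sum>j<n. \<bar>real_of_int (B i j)\<bar>) \<le> K"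
    using assms(2) unfolding height_le_def by blast
  have "x * y * v i = (\<Sum>j<n. of_int (\<Sum>k<n. A i k * B k j) * v j)" if "i < n" for i
  proof -
    have "x * y * v i = y * (x * v i)" by (simp only: mult_ac)
    also have "\<dots> = y * (\<Sum>k<n. of_int (A i k) * v k)" by (simp only: A(1)[OF that])
    also have "\<dots> = (\<Sum>k<n. of_int (A i k) * (y * v k))"
      by (simp add: sum_distrib_left mult.left_commute)
    also have "\<dots> = (\<Sum>k<n. of_int (A i k) * (\<Sum>j<n. of_int (B k j) * v j))"
      using B(1) by (intro sum.cong) auto
    also have "\<dots> = (\<Sum>k<n. \<Sum>j<n. of_int (A i k * B k j) * v j)"
      by (simp add: sum_distrib_left mult.assoc)
    also have "\<dots> = (\<Sum>j<n. of_int (\<Sum>k<n. A i k * B k j) * v j)"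
      by (subst sum.swap) (simp add: sum_distrib_right)
    finally show ?thesis .
  qed
  moreover have "(\<Sum>j<n. \<bar>real_of_int (\<Sum>k<n. A i k * B k j)\<bar>) \<le> H * K" if "i < n" for i
  proof -
    have "K \<ge> 0" using B(2)[OF that] by (rule order.trans[rotated]) (simp add: sum_nonneg)
    have "(\<Sum>j<n. \<bar>real_of_int (\<Sum>k<n. A i k * B k j)\<bar>)
        \<le> (\<Sum>j<n. \<Sum>k<n. \<bar>real_of_int (A i k)\<bar> * \<bar>real_of_int (B k j)\<bar>)"
      unfolding of_int_sum of_int_mult abs_mult[symmetric] by (intro sum_mono sum_abs)
    also have "\<dots> = (\<Sum>k<n. \<bar>real_of_int (A i k)\<bar> * (\<Sum>j<n. \<bar>real_of_int (B k j)\<bar>))"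
      by (subst sum.swap) (simp add: sum_distrib_left)
    also have "\<dots> \<le> (\<Sum>k<n. \<bar>real_of_int (A i k)\<bar> * K)"
      by (intro sum_mono mult_left_mono B(2)) auto
    also have "\<dots> \<le> H * K"
      unfolding sum_distrib_right[symmetric] using A(2)[OF that] \<open>K \<ge> 0\<close> by (rule mult_right_mono)
    finally show ?thesis .
  qed
  ultimately show ?thesis
    unfolding height_le_def by (intro exI[of _ "\<lambda>i j. \<Sum>k<n. A i k * B k j"]) blast
qed

lemma height_le_0: "height_le n v 0 0" and height_le_1: "height_le n v 1 1"
  using height_le_of_int[of n v 0] height_le_of_int[of n v 1] by simp_all

lemma height_le_power: "height_le n v x H \<Longrightarrow> height_le n v (x ^ k) (H ^ k)"
  by (induction k) (simp_all add: height_le_1 height_le_mult)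

lemma height_le_sum:
  "finite I \<Longrightarrow> (\<And>i. i \<in> I \<Longrightarrow> height_le n v (f i) (H i)) \<Longrightarrow> height_le n v (\<Sum>i\<in>I. f i) (\<Sum>i\<in>I. H i)"
  by (induction I rule: finite_induct) (simp_all add: height_le_0 height_le_add)

lemma height_le_prod:
  "finite I \<Longrightarrow> (\<And>i. i \<in> I \<Longrightarrow> height_le n v (f i) (H i)) \<Longrightarrow> height_le n v (\<Prod>i\<in>I. f i) (\<Prod>i\<in>I. H i)"
  by (induction I rule: finite_induct) (simp_all add: height_le_1 height_le_mult)

lemma height_le_det:
  assumes A: "A \<in> carrier_mat m m"
    and "\<And>i j. i < m \<Longrightarrow> j < m \<Longrightarrow> height_le n v (A $$ (i, j)) E"
  shows "height_le n v (det A) (fact m * E ^ m)"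
proof -
  have sgn: "\<bar>real_of_int (sign p)\<bar> = 1" for p :: "nat \<Rightarrow> nat"
    by (simp add: sign_def)
  have "height_le n v (signof p * (\<Prod>i = 0..<m. A $$ (i, p i))) (E ^ m)" if "p permutes {0..<m}" for p
  proof -
    have "height_le n v (\<Prod>i = 0..<m. A $$ (i, p i)) (\<Prod>i = 0..<m. E)"
      using that by (intro height_le_prod) (auto intro!: assms(2) simp: permutes_in_image)
    from height_le_mult[OF height_le_of_int[of n v "sign p"] this] show ?thesis
      by (simp add: sgn)
  qed
  then have "height_le n v (det A) (\<Sum>p\<in>{p. p permutes {0..<m}}. E ^ m)"
    unfolding det_def'[OF A] by (intro height_le_sum) (auto simp: finite_permutations)
  then show ?thesis by (simp add: card_permutations)
qed

text \<open>
  If \<open>x \<noteq> 0\<close> acts by the integer matrix \<open>A\<close>, then \<open>det A\<close> is a nonzero integer: a relation \<open>c\<close>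
  between the rows of \<open>A\<close> gives \<open>x * (\<Sum>i<n. c i * v i) = 0\<close>, so \<open>c = 0\<close> by independence. Applying the adjugate of \<open>A\<close> to \<open>A v = x v\<close> gives
  \<open>det A * v 0 = x * (adj A v) 0\<close>, where the entries of \<open>adj A\<close> are at most
  \<open>fact (n - 1) * H ^ (n - 1)\<close>.
\<close>
lemma liouville_inequality:
  assumes n: "n > 0" and ind: "\<And>c :: nat \<Rightarrow> rat. (\<Sum>i<n. of_rat (c i) * v i) = 0 \<Longrightarrow> \<forall>i<n. c i = 0"
  obtains C where "C > 0" "\<And>x H. height_le n v x H \<Longrightarrow> x \<noteq> 0 \<Longrightarrow> 1 \<le> C * H ^ (n - 1) * \<bar>x\<bar>"
proof -
  have v0: "v 0 \<noteq> 0" by (rule rat_independent_nonzero[OF ind n])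
  define V where "V = (\<Sum>k<n. \<bar>v k\<bar>)"
  have "\<bar>v 0\<bar> \<le> V" unfolding V_def using n by (intro member_le_sum) auto
  with v0 have V: "V > 0" by linarith
  show thesis
  proof (rule that[of "fact (n - 1) * V / \<bar>v 0\<bar>"])
    show "fact (n - 1) * V / \<bar>v 0\<bar> > 0" using V v0 by simp
  next
    fix x H assume "height_le n v x H" and x: "x \<noteq> 0"
    then obtain A where A: "\<And>i. i < n \<Longrightarrow> x * v i = (\<Sum>j<n. of_int (A i j) * v j)"
      "\<And>i. i < n \<Longrightarrow> (\<Sum>j<n. \<bar>real_of_int (A i j)\<bar>) \<le> H"
      unfolding height_le_def by blast
    define Z where "Z = mat n n (\<lambda>(i, j). A i j)"
    define R where "R = map_mat real_of_int Z"
    have Z: "Z \<in> carrier_mat n n" and R: "R \<in> carrier_mat n n" by (simp_all add: Z_def R_def)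
    have "det Z \<noteq> 0"
    proof
      assume "det Z = 0"
      then have "det (transpose_mat Z) = 0" by (simp add: det_transpose[OF Z])
      then obtain w where w: "w \<in> carrier_vec n" "w \<noteq> 0\<^sub>v n" "transpose_mat Z *\<^sub>v w = 0\<^sub>v n"
        using det_0_iff_vec_prod_zero[of "transpose_mat Z" n] Z by auto
      have ker: "(\<Sum>i<n. A i j * w $ i) = 0" if "j < n" for j
        using arg_cong[OF w(3), of "\<lambda>u. u $ j"] that w(1)
        by (simp add: Z_def scalar_prod_def lessThan_atLeast0)
      have "x * (\<Sum>i<n. of_rat (of_int (w $ i)) * v i) = (\<Sum>i<n. of_int (w $ i) * (x * v i))"
        by (simp add: sum_distrib_left mult.left_commute)
      also have "\<dots> = (\<Sum>i<n. \<Sum>j<n. of_int (A i j * w $ i) * v j)"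
        by (simp add: A(1) sum_distrib_left mult_ac)
      also have "\<dots> = (\<Sum>j<n. of_int (\<Sum>i<n. A i j * w $ i) * v j)"
        by (subst sum.swap) (simp add: sum_distrib_right)
      also have "\<dots> = 0" by (simp add: ker)
      finally have "(\<Sum>i<n. of_rat (of_int (w $ i)) * v i) = 0" using x by simp
      from ind[OF this] w(1,2) show False by (auto simp: vec_eq_iff)
    qed
    moreover have "det R = of_int (det Z)" by (simp add: R_def)
    ultimately have det1: "1 \<le> \<bar>det R\<bar>" by simp
    have entry: "\<bar>R $$ (i, j)\<bar> \<le> H" if "i < n" "j < n" for i j
    proof -
      have "\<bar>real_of_int (A i j)\<bar> \<le> (\<Sum>j<n. \<bar>real_of_int (A i j)\<bar>)"
        using that by (intro member_le_sum) auto
      with A(2)[OF that(1)] that show ?thesis by (simp add: R_def Z_def)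
    qed
    have adj: "\<bar>adj_mat R $$ (0, k)\<bar> \<le> fact (n - 1) * H ^ (n - 1)" if "k < n" for k
    proof -
      have "\<bar>adj_mat R $$ (0, k)\<bar> = \<bar>det (mat_delete R k 0)\<bar>"
        using R n that by (simp add: adj_mat_def cofactor_def abs_mult power_abs)
      also have "\<dots> \<le> fact (n - 1) * (\<Prod>j<n - 1. H)"
        using R by (intro abs_det_le mat_delete_carrier[OF R]) (auto simp: mat_delete_def intro!: entry)
      finally show ?thesis by simp
    qed
    have "det R * v 0 = (\<Sum>j<n. (adj_mat R * R) $$ (0, j) * v j)"
      using n by (simp add: adj_mat(3)[OF R] if_distrib[of "\<lambda>u. u * _"] if_distrib[of "\<lambda>u. _ * u"] cong: if_cong)
    also have "\<dots> = (\<Sum>j<n. \<Sum>k<n. adj_mat R $$ (0, k) * (of_int (A k j) * v j))"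
      using n adj_mat(1)[OF R] R
      by (intro sum.cong) (auto simp: scalar_prod_def sum_distrib_right R_def Z_def lessThan_atLeast0 mult.assoc)
    also have "\<dots> = x * (\<Sum>k<n. adj_mat R $$ (0, k) * v k)"
      by (subst sum.swap) (simp add: sum_distrib_left[symmetric] A(1)[symmetric] mult.left_commute[of _ x])
    finally have "\<bar>det R\<bar> * \<bar>v 0\<bar> = \<bar>x\<bar> * \<bar>\<Sum>k<n. adj_mat R $$ (0, k) * v k\<bar>"
      by (metis abs_mult)
    also have "\<bar>\<Sum>k<n. adj_mat R $$ (0, k) * v k\<bar> \<le> (\<Sum>k<n. \<bar>adj_mat R $$ (0, k) * v k\<bar>)" by (rule sum_abs)
    also have "\<dots> \<le> (\<Sum>k<n. fact (n - 1) * H ^ (n - 1) * \<bar>v k\<bar>)"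
      unfolding abs_mult by (intro sum_mono mult_right_mono adj) auto
    also have "\<dots> = fact (n - 1) * H ^ (n - 1) * V" by (simp add: V_def sum_distrib_left)
    finally have "\<bar>det R\<bar> * \<bar>v 0\<bar> \<le> \<bar>x\<bar> * (fact (n - 1) * H ^ (n - 1) * V)"
      by (simp add: mult_left_mono)
    moreover have "1 * \<bar>v 0\<bar> \<le> \<bar>det R\<bar> * \<bar>v 0\<bar>" using det1 by (intro mult_right_mono) auto
    ultimately have "\<bar>v 0\<bar> \<le> \<bar>x\<bar> * (fact (n - 1) * H ^ (n - 1) * V)" by linarith
    then show "1 \<le> fact (n - 1) * V / \<bar>v 0\<bar> * H ^ (n - 1) * \<bar>x\<bar>"
      using v0 by (simp add: field_simps)
  qed
qed

lemma common_denominator: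
  assumes "finite (S :: rat set)"
  shows "\<exists>D :: int. D > 0 \<and> (\<forall>r\<in>S. of_int D * r \<in> \<int>)"
  using assms
proof (induction S)
  case empty
  then show ?case by (intro exI[of _ 1]) simp
next
  case (insert r S)
  then obtain D :: int where D: "D > 0" "\<forall>r\<in>S. of_int D * r \<in> \<int>" by blast
  obtain a b :: int where ab: "b > 0" "r = of_int a / of_int b"
    by (metis quotient_of_denom_pos quotient_of_div surj_pair)
  have "of_int (D * b) * s \<in> \<int>" if "s \<in> insert r S" for s
  proof (cases "s = r")
    case True
    have "of_int (D * b) * r = of_int (D * a)" using ab by simp
    then show ?thesis using True by (metis Ints_of_int)
  next
    case False
    then have "of_int D * s \<in> \<int>" using that D(2) by blast
    then have "of_int b * (of_int D * s) \<in> \<int>" by (rule Ints_mult[OF Ints_of_int])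
    then show ?thesis by (simp add: mult_ac)
  qed
  with D(1) ab(1) show ?case by (intro exI[of _ "D * b"]) auto
qed

lemma height_le_exists:
  assumes "\<forall>i<n. x * v i = (\<Sum>j<n. of_rat (A i j) * v j)"
  shows "\<exists>D H. D > (0::int) \<and> height_le n v (of_int D * x) H"
proof -
  have "finite ((\<lambda>(i, j). A i j) ` ({..<n} \<times> {..<n}))" by simp
  from common_denominator[OF this] obtain D :: int where D: "D > 0"
      "\<And>i j. i < n \<Longrightarrow> j < n \<Longrightarrow> of_int D * A i j \<in> \<int>" by fastforce
  define B where "B i j = \<lfloor>of_int D * A i j\<rfloor>" for i j
  have B: "of_int D * A i j = of_int (B i j)" if "i < n" "j < n" for i j
    using D(2)[OF that] by (auto simp: B_def elim!: Ints_cases)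
  have B': "real_of_int D * of_rat (A i j) = of_int (B i j)" if "i < n" "j < n" for i j
    using arg_cong[OF B[OF that], of "of_rat :: rat \<Rightarrow> real"] by (simp add: of_rat_mult)
  have "of_int D * x * v i = (\<Sum>j<n. of_int (B i j) * v j)" if "i < n" for i
    using assms that by (simp add: mult.assoc sum_distrib_left mult.assoc[symmetric] B')
  moreover have "(\<Sum>j<n. \<bar>real_of_int (B i j)\<bar>) \<le> (\<Sum>i<n. \<Sum>j<n. \<bar>real_of_int (B i j)\<bar>)" if "i < n" for i
    using that by (intro member_le_sum[of i "{..<n}" "\<lambda>i. \<Sum>j<n. \<bar>real_of_int (B i j)\<bar>"]) (auto intro: sum_nonneg)
  ultimately have "height_le n v (of_int D * x) (\<Sum>i<n. \<Sum>j<n. \<bar>real_of_int (B i j)\<bar>)"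
    unfolding height_le_def by (intro exI[of _ B]) auto
  with D(1) show ?thesis by blast
qed

lemma height_le_common:
  assumes "finite \<Gamma>"
    and "\<And>g. g \<in> \<Gamma> \<Longrightarrow> \<exists>A :: nat \<Rightarrow> nat \<Rightarrow> rat. \<forall>i<n. g * v i = (\<Sum>j<n. of_rat (A i j) * v j)"
  shows "\<exists>D K. D > (0::int) \<and> of_int D \<le> K \<and> (\<forall>g\<in>\<Gamma>. height_le n v (of_int D * g) K)"
  using assms
proof (induction \<Gamma>)
  case empty
  then show ?case by (intro exI[of _ "1::int"] exI[of _ "1::real"]) simp
next
  case (insert x \<Gamma>)
  then obtain D K where D: "D > 0" "of_int D \<le> K" "\<forall>g\<in>\<Gamma>. height_le n v (of_int D * g) K"
    by auto
  obtain A :: "nat \<Rightarrow> nat \<Rightarrow> rat" where "\<forall>i<n. x * v i = (\<Sum>j<n. of_rat (A i j) * v j)"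
    using insert.prems[of x] by auto
  then obtain D' H where D': "D' > (0::int)" "height_le n v (of_int D' * x) H"
    using height_le_exists by blast
  \<comment> \<open>The three summands dominate the common denominator, the rescaled old heights and the new height.\<close>
  define K' where "K' = of_int (D * D') + of_int D' * K + of_int D * \<bar>H\<bar>"
  have pos: "of_int D * \<bar>H\<bar> \<ge> 0" "of_int D' * K \<ge> 0" "of_int (D * D') \<ge> (0::real)"
    "of_int D * H \<le> of_int D * \<bar>H\<bar>"
    using D D' by (auto intro!: mult_nonneg_nonneg mult_left_mono)
  have scale: "height_le n v (of_int (E * F) * g) (of_int E * B)"
    if "height_le n v (of_int F * g) B" "E > 0" for E F :: int and g B
    using height_le_mult[OF height_le_of_int[of n v E] that(1)] that(2) by (simp add: mult.assoc)
  have "height_le n v (of_int (D * D') * g) K'" if "g \<in> insert x \<Gamma>" for g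
  proof (cases "g = x")
    case True
    with scale[OF D'(2) D(1)] pos show ?thesis
      by (auto intro: height_le_mono simp: K'_def)
  next
    case False
    with that D(3) have "height_le n v (of_int D * g) K" by auto
    from scale[OF this D'(1)] pos show ?thesis
      by (auto intro: height_le_mono simp: K'_def mult.commute[of D])
  qed
  moreover have "of_int (D * D') \<le> K'" using pos by (simp add: K'_def)
  ultimately show ?case using D(1) D'(1) by (intro exI[of _ "D * D'"] exI[of _ K']) simp
qed

text \<open>
  Padding with powers of the denominator \<open>d\<close> gives all entries of a matrix the same denominator.
\<close>
lemma height_le_scaled_power:
  assumes "height_le n v d K" "height_le n v (d * x) K" "e \<le> N"
  shows "height_le n v (d ^ N * x ^ e) (K ^ N)"
proof -
  have "height_le n v (d ^ (N - e) * (d * x) ^ e) (K ^ (N - e) * K ^ e)"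
    by (intro height_le_mult height_le_power assms)
  moreover have "d ^ (N - e) * (d * x) ^ e = d ^ N * x ^ e"
    using assms(3) by (simp add: power_mult_distrib mult.assoc[symmetric] power_add[symmetric])
  ultimately show ?thesis using assms(3) by (simp add: power_add[symmetric])
qed

section \<open>The determinant of monomials times exponentials\<close>

text \<open>
  The row index \<open>i < S * T\<close> encodes the pair of the exponent \<open>i div S < T\<close> and the frequency
  \<open>i mod S < S\<close>. A vanishing linear combination of the rows is an exponential polynomial with
  \<open>S * T\<close> zeros.
\<close>
lemma exp_monom_det_nonzero:
  fixes x :: "nat \<Rightarrow> real"
  assumes "w \<noteq> 0" "S > 0" and inj: "inj_on x {..<S * T}"
  shows "det (mat (S * T) (S * T) (\<lambda>(i, j). x j ^ (i div S) * exp (real (i mod S) * w * x j))) \<noteq> 0"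
proof
  define L where "L = S * T"
  define F where "F = mat L L (\<lambda>(i, j). x j ^ (i div S) * exp (real (i mod S) * w * x j))"
  assume "det (mat (S * T) (S * T) (\<lambda>(i, j). x j ^ (i div S) * exp (real (i mod S) * w * x j))) = 0"
  then have "det F = 0" by (simp add: F_def L_def)
  have F: "F \<in> carrier_mat L L" by (simp add: F_def)
  have "det (transpose_mat F) = 0"
    using \<open>det F = 0\<close> by (simp add: det_transpose[OF F])
  then obtain c where c: "c \<in> carrier_vec L" "c \<noteq> 0\<^sub>v L" "transpose_mat F *\<^sub>v c = 0\<^sub>v L"
    using det_0_iff_vec_prod_zero[of "transpose_mat F" L] F by auto
  define P where "P s = (\<Sum>t<T. monom (c $ (t * S + s)) t)" for s
  have vanish: "(\<Sum>s<S. poly (P s) z * exp (real s * w * z)) = 0" if "z \<in> x ` {..<L}" for z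
  proof -
    obtain j where j: "j < L" "z = x j" using \<open>z \<in> x ` {..<L}\<close> by auto
    have "(\<Sum>i<L. c $ i * (z ^ (i div S) * exp (real (i mod S) * w * z))) = 0"
      using arg_cong[OF c(3), of "\<lambda>u. u $ j"] j c(1)
      by (simp add: F_def scalar_prod_def lessThan_atLeast0 mult.commute)
    also have "(\<Sum>i<L. c $ i * (z ^ (i div S) * exp (real (i mod S) * w * z)))
       = (\<Sum>t<T. \<Sum>i=t*S..<t*S+S. c $ i * (z ^ (i div S) * exp (real (i mod S) * w * z)))"
      by (simp add: sum.nat_group L_def mult.commute[of S])
    also have "\<dots> = (\<Sum>t<T. \<Sum>s<S. c $ (t * S + s) * (z ^ t * exp (real s * w * z)))"
    proof (rule sum.cong[OF refl])
      fix t
      have "(\<Sum>i=t*S..<t*S+S. c $ i * (z ^ (i div S) * exp (real (i mod S) * w * z)))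
          = (\<Sum>s=0..<S. c $ (s + t * S) * (z ^ ((s + t * S) div S) * exp (real ((s + t * S) mod S) * w * z)))"
        using sum.shift_bounds_nat_ivl[of "\<lambda>i. c $ i * (z ^ (i div S) * exp (real (i mod S) * w * z))" 0 "t * S" S]
        by (simp add: add.commute)
      then show "(\<Sum>i=t*S..<t*S+S. c $ i * (z ^ (i div S) * exp (real (i mod S) * w * z)))
          = (\<Sum>s<S. c $ (t * S + s) * (z ^ t * exp (real s * w * z)))"
        using \<open>S > 0\<close> by (simp add: lessThan_atLeast0 add.commute[of "t * S"])
    qed
    also have "\<dots> = (\<Sum>s<S. poly (P s) z * exp (real s * w * z))"
      by (subst sum.swap) (simp add: P_def poly_sum poly_monom sum_distrib_right mult.assoc)
    finally show ?thesis .
  qed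
  have P0: "P s = 0" if "s < S" for s
  proof (rule exp_poly_eq_0[where r = "\<lambda>s. real s * w" and S = S and Z = "x ` {..<L}" and T = T])
    show "inj_on (\<lambda>s. real s * w) {..<S}" using \<open>w \<noteq> 0\<close> by (simp add: inj_on_def)
    show "degree (P s) < T" if "s < S" for s
    proof -
      have "T > 0" using c(1,2) by (auto simp: L_def vec_eq_iff intro!: Nat.gr0I)
      moreover have "degree (P s) \<le> T - 1"
        unfolding P_def by (rule degree_sum_le) (auto intro: order.trans[OF degree_monom_le])
      ultimately show ?thesis by simp
    qed
    show "card (x ` {..<L}) = S * T" using inj by (simp add: card_image L_def)
  qed (use that vanish in auto)
  have "c $ i = 0" if "i < L" for i
  proof -
    have "i div S < T" using that by (simp add: L_def less_mult_imp_div_less mult.commute)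
    then have "coeff (P (i mod S)) (i div S) = c $ i"
      by (simp add: P_def coeff_sum)
    then show ?thesis using P0[of "i mod S"] \<open>S > 0\<close> by simp
  qed
  with c(1,2) show False by (auto simp: vec_eq_iff)
qed

lemma abs_exp_monom_det_le:
  fixes x :: "nat \<Rightarrow> real"
  assumes "S > 0" "X \<ge> 1" and inj: "inj_on x {..<S * T}" and sub: "\<And>j. j < S * T \<Longrightarrow> \<bar>x j\<bar> \<le> X"
  shows "\<bar>det (mat (S * T) (S * T) (\<lambda>(i, j). x j ^ (i div S) * exp (real (i mod S) * w * x j)))\<bar>
    \<le> fact (S * T) * (X ^ T * exp (S * \<bar>w\<bar> * X)) ^ (S * T)
        * (\<Prod>m<S * T. (2 * X * (T / X + S * \<bar>w\<bar>)) ^ m / fact m)"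
proof -
  define f where "f i k t = poly ((twisted_deriv (real (i mod S) * w) ^^ k) (monom 1 (i div S))) t
      * exp (real (i mod S) * w * t)" for i k and t :: real
  have "\<bar>det (mat (S * T) (S * T) (\<lambda>(i, j). f i 0 (x j)))\<bar>
     \<le> fact (S * T) * (X ^ T * exp (S * \<bar>w\<bar> * X)) ^ (S * T)
        * (\<Prod>m<S * T. (2 * X * (T / X + S * \<bar>w\<bar>)) ^ m / fact m)"
  proof (rule abs_interpolation_det_le[OF _ inj])
    fix i k t
    show "(f i k has_real_derivative f i (Suc k) t) (at t)"
      unfolding f_def funpow.simps comp_def by (rule has_derivative_exp_poly)
  next
    show "x ` {..<S * T} \<subseteq> {- X..X}" using sub by (force simp: abs_le_iff)
  next
    fix i k t assume i: "i < S * T" and t: "t \<in> {- X..X}"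
    have "i div S \<le> T" using i by (simp add: less_mult_imp_div_less mult.commute less_imp_le)
    then have "\<bar>f i k t\<bar> \<le> X ^ T * exp (\<bar>real (i mod S) * w\<bar> * X) * (T / X + \<bar>real (i mod S) * w\<bar>) ^ k"
      unfolding f_def using assms(2) t by (intro abs_exp_monom_deriv_le) auto
    also have "\<dots> \<le> X ^ T * exp (S * \<bar>w\<bar> * X) * (T / X + S * \<bar>w\<bar>) ^ k"
    proof -
      have "\<bar>real (i mod S) * w\<bar> \<le> S * \<bar>w\<bar>"
        using \<open>S > 0\<close> by (simp add: abs_mult mult_right_mono less_imp_le)
      then show ?thesis
        using assms(2) by (intro mult_mono power_mono) (auto intro!: mult_right_mono)
    qed
    finally show "\<bar>f i k t\<bar> \<le> X ^ T * exp (S * \<bar>w\<bar> * X) * (T / X + S * \<bar>w\<bar>) ^ k" .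
  qed
  then show ?thesis by (simp add: f_def poly_monom)
qed

text \<open>
  The factorials are bounded below by \<open>exp L \<ge> L ^ m / fact m\<close>, a single term of the
  exponential series.
\<close>
lemma prod_power_div_fact_le:
  fixes Q L :: real
  assumes "Q \<ge> 0" "L > 0"
  shows "(\<Prod>m<n. Q ^ m / fact m) \<le> (Q / L) ^ (\<Sum>m<n. m) * exp (n * L)"
proof -
  have "Q ^ m / fact m \<le> (Q / L) ^ m * exp L" for m
  proof -
    have "(\<Sum>k\<in>{m}. L ^ k /\<^sub>R fact k) \<le> (\<Sum>k. L ^ k /\<^sub>R fact k)"
      using assms(2) by (intro sum_le_suminf summable_exp_generic) auto
    then have "L ^ m / fact m \<le> exp L" by (simp add: exp_def field_simps)
    from mult_left_mono[OF this, of "(Q / L) ^ m"] assms show ?thesis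
      by (simp add: power_divide)
  qed
  then have "(\<Prod>m<n. Q ^ m / fact m) \<le> (\<Prod>m<n. (Q / L) ^ m * exp L)"
    using assms by (intro prod_mono) auto
  then show ?thesis by (simp add: prod.distrib power_sum exp_of_nat_mult)
qed

text \<open>
  The term \<open>- (s ^ 8 / 2) * ln s\<close> dominates all others.
\<close>
lemma dominant_term_negative:
  fixes a0 a1 a2 a3 a4 :: real
  shows "\<exists>s::nat. s > (0::nat) \<and> a0 + a1 * real s ^ 4 * ln (real s) + a2 * real s ^ 7 * ln (real s) + a3 * real s ^ 7 + real s ^ 8
            + (real s ^ 4 * (real s ^ 4 - 1)) / 2 * (a4 - ln (real s)) < 0"
proof -
  have "filterlim (\<lambda>s::nat. a0 + a1 * real s ^ 4 * ln (real s) + a2 * real s ^ 7 * ln (real s) + a3 * real s ^ 7 + real s ^ 8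
            + (real s ^ 4 * (real s ^ 4 - 1)) / 2 * (a4 - ln (real s))) at_bot at_top"
    by real_asymp
  then have "\<forall>\<^sub>F s::nat in at_top. a0 + a1 * real s ^ 4 * ln (real s) + a2 * real s ^ 7 * ln (real s) + a3 * real s ^ 7 + real s ^ 8
            + (real s ^ 4 * (real s ^ 4 - 1)) / 2 * (a4 - ln (real s)) < 0"
    unfolding filterlim_at_bot_dense by blast
  from eventually_conj[OF eventually_gt_at_top[of "0::nat"] this] show ?thesis
    by (rule eventually_happens'[OF sequentially_bot])
qed

section \<open>The Gelfond--Schneider theorem for real numbers\<close>

lemma irrational_combination_inj:
  assumes "\<beta> \<notin> \<rat>" "real i + real j * \<beta> = real i' + real j' * \<beta>"
  shows "i = i' \<and> j = j'"
proof -
  have "j = j'"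
  proof (rule ccontr)
    assume "j \<noteq> j'"
    then have "\<beta> = (real i' - real i) / (real j - real j')"
      using assms(2) by (simp add: field_simps)
    then have "\<beta> \<in> \<rat>" by simp
    with assms(1) show False by contradiction
  qed
  with assms(2) show ?thesis by simp
qed

theorem gelfond_schneider_real:
  fixes \<alpha> \<beta> :: real
  assumes alg: "algebraic \<alpha>" "algebraic \<beta>" and \<alpha>: "\<alpha> > 0" "\<alpha> \<noteq> 1" and \<beta>: "\<beta> \<notin> \<rat>"
  shows "\<not> algebraic (\<alpha> powr \<beta>)"
proof
  define \<gamma> where "\<gamma> = \<alpha> powr \<beta>"
  define w where "w = ln \<alpha>"
  \<comment> \<open>The interpolation nodes lie in \<open>{- X..X}\<close> for \<open>X = s\<^sup>2 * c\<^sub>1\<close>, and \<open>c * s ^ 3\<close> is the base of the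
     powers in the bound of \<open>abs_exp_monom_det_le\<close>.\<close>
  define c\<^sub>1 where "c\<^sub>1 = 1 + \<bar>\<beta>\<bar>"
  define c where "c = 2 + 2 * c\<^sub>1 * \<bar>w\<bar>"
  assume "algebraic (\<alpha> powr \<beta>)"
  with alg have gens: "g \<in> {\<alpha>, \<beta>, \<gamma>} \<Longrightarrow> algebraic g" for g by (auto simp: \<gamma>_def)
  have w: "w \<noteq> 0" "exp w = \<alpha>" "exp (\<beta> * w) = \<gamma>"
    using \<alpha> by (auto simp: w_def \<gamma>_def powr_def)
  have c\<^sub>1: "c\<^sub>1 \<ge> 1" and c: "c > 0" by (auto simp: c\<^sub>1_def c_def add_pos_nonneg)
  obtain n v where n: "n > 0"
    and ind: "\<And>c :: nat \<Rightarrow> rat. (\<Sum>i<n. of_rat (c i) * v i) = 0 \<Longrightarrow> \<forall>i<n. c i = 0"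
    and ops: "\<And>g. g \<in> {\<alpha>, \<beta>, \<gamma>} \<Longrightarrow> \<exists>A :: nat \<Rightarrow> nat \<Rightarrow> rat. \<forall>i<n. g * v i = (\<Sum>j<n. of_rat (A i j) * v j)"
    by (rule algebraic_common_basis[of "{\<alpha>, \<beta>, \<gamma>}"]) (use gens in auto)
  obtain D K where D: "D > (0::int)" "of_int D \<le> K" "\<forall>g\<in>{\<alpha>, \<beta>, \<gamma>}. height_le n v (of_int D * g) K"
    using height_le_common[of "{\<alpha>, \<beta>, \<gamma>}" n v] ops by blast
  define d where "d = real_of_int D"
  have d: "1 \<le> d" "d \<le> K" and K: "K \<ge> 1" using D(1,2) by (auto simp: d_def)
  have hd: "height_le n v d K" using height_le_of_int[of n v D] D by (auto simp: d_def intro: height_le_mono)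
  have hg: "height_le n v (d * \<alpha>) K" "height_le n v (d * \<beta>) K" "height_le n v (d * \<gamma>) K"
    using D(3) by (auto simp: d_def)
  obtain C where C: "C > 0" "\<And>x H. height_le n v x H \<Longrightarrow> x \<noteq> 0 \<Longrightarrow> 1 \<le> C * H ^ (n - 1) * \<bar>x\<bar>"
    using liouville_inequality[OF n ind] by blast
  \<comment> \<open>Liouville's inequality for the determinant, cleared of denominators by a power of \<open>d\<close>, combined
     with the analytic upper bound, with \<open>d\<close> estimated by \<open>K\<close>.\<close>
  have key: "1 \<le> C * (fact L * ((2 * (real s)\<^sup>2 * K ^ 3) ^ s ^ 3) ^ L) ^ (n - 1) * ((K ^ (3 * s ^ 3)) ^ L *
      (fact L * (((real s)\<^sup>2 * c\<^sub>1) ^ s ^ 3 * exp (real s * \<bar>w\<bar> * ((real s)\<^sup>2 * c\<^sub>1))) ^ L * ((c / real s) ^ (\<Sum>m<L. m) * exp (real L * real L))))"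
    if s: "s > 0" and L: "L = s * s ^ 3" for s L :: nat
  proof -
    define M where "M = s\<^sup>2"
    define X where "X = (real s)\<^sup>2 * c\<^sub>1"
    define x where "x j = real (j div M) + real (j mod M) * \<beta>" for j
    define F where "F = mat L L (\<lambda>(i, j). x j ^ (i div s) * exp (real (i mod s) * w * x j))"
    have M: "M > 0" using s by (simp add: M_def)
    have LM: "L = M * M" by (simp add: L M_def power2_eq_square power3_eq_cube)
    have lt: "j div M < M" "j mod M < M" if "j < L" for j
      using that M by (auto simp: LM less_mult_imp_div_less)
    have X: "X \<ge> 1"
      unfolding X_def using s c\<^sub>1 mult_mono[of 1 "(real s)\<^sup>2" 1 c\<^sub>1] by simp
    have inj: "inj_on x {..<L}"
    proof (rule inj_onI)
      fix j k assume "x j = x k"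
      from irrational_combination_inj[OF \<beta> this[unfolded x_def]]
      show "j = k" by (metis div_mult_mod_eq)
    qed
    have xX: "\<bar>x j\<bar> \<le> X" if "j < L" for j
    proof -
      have "\<bar>x j\<bar> \<le> real (j div M) + real (j mod M) * \<bar>\<beta>\<bar>"
        unfolding x_def by (rule order.trans[OF abs_triangle_ineq]) (simp add: abs_mult)
      also have "\<dots> \<le> real M + real M * \<bar>\<beta>\<bar>"
        using lt[OF that] by (intro add_mono mult_right_mono) auto
      finally show ?thesis by (simp add: X_def M_def c\<^sub>1_def algebra_simps)
    qed
    have F: "F \<in> carrier_mat L L" by (simp add: F_def)
    have "det F \<noteq> 0"
      using exp_monom_det_nonzero[of w s x "s ^ 3"] w(1) s inj by (simp add: F_def L)
    then have nz: "det ((d ^ (3 * s ^ 3)) \<cdot>\<^sub>m F) \<noteq> 0" using d by simp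
    have "height_le n v (det ((d ^ (3 * s ^ 3)) \<cdot>\<^sub>m F)) (fact L * ((2 * (real s)\<^sup>2 * K ^ 3) ^ s ^ 3) ^ L)"
    proof (rule height_le_det)
      fix i j assume ij: "i < L" "j < L"
      define t where "t = i div s"
      define \<sigma> where "\<sigma> = i mod s"
      define a where "a = j div M"
      define b where "b = j mod M"
      have xj: "x j = real a + real b * \<beta>" by (simp add: x_def a_def b_def)
      have t: "t \<le> s ^ 3"
        using ij(1) by (simp add: t_def L less_mult_imp_div_less mult.commute less_imp_le)
      have ab: "a \<le> M" "b \<le> M" "\<sigma> \<le> s"
        using lt[OF ij(2)] s by (simp_all add: a_def b_def \<sigma>_def less_imp_le)
      \<comment> \<open>The choice \<open>M = s\<^sup>2\<close> makes all three exponents \<open>t\<close>, \<open>\<sigma> * a\<close>, \<open>\<sigma> * b\<close> at most \<open>s ^ 3\<close>.\<close>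
      have \<sigma>ab: "\<sigma> * a \<le> s ^ 3" "\<sigma> * b \<le> s ^ 3"
        using mult_le_mono[OF ab(3,1)] mult_le_mono[OF ab(3,2)]
        by (simp_all add: M_def power2_eq_square power3_eq_cube)
      have MK: "K \<le> 2 * real M * K" using M K mult_right_mono[of 1 "2 * real M" K] by simp
      have "height_le n v (of_int (int a) * d + of_int (int b) * (d * \<beta>)) (\<bar>of_int (int a)\<bar> * K + \<bar>of_int (int b)\<bar> * K)"
        by (intro height_le_add height_le_mult height_le_of_int hd hg)
      moreover have "\<bar>of_int (int a)\<bar> * K + \<bar>of_int (int b)\<bar> * K \<le> real M * K + real M * K"
        using ab K by (intro add_mono mult_right_mono) auto
      moreover have "of_int (int a) * d + of_int (int b) * (d * \<beta>) = d * x j"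
        by (simp add: xj algebra_simps)
      ultimately have hx: "height_le n v (d * x j) (2 * real M * K)"
        by (auto intro: height_le_mono)
      have "height_le n v (d ^ s ^ 3 * x j ^ t * (d ^ s ^ 3 * \<alpha> ^ (\<sigma> * a)) * (d ^ s ^ 3 * \<gamma> ^ (\<sigma> * b)))
          ((2 * real M * K) ^ s ^ 3 * K ^ s ^ 3 * K ^ s ^ 3)"
        by (intro height_le_mult height_le_scaled_power height_le_mono[OF hd MK] hx hd hg t \<sigma>ab)
      moreover have "(2 * real M * K) ^ s ^ 3 * K ^ s ^ 3 * K ^ s ^ 3 = (2 * (real s)\<^sup>2 * K ^ 3) ^ s ^ 3"
        unfolding power_mult_distrib[symmetric] by (simp add: M_def power3_eq_cube mult.assoc)
      moreover have "d ^ s ^ 3 * x j ^ t * (d ^ s ^ 3 * \<alpha> ^ (\<sigma> * a)) * (d ^ s ^ 3 * \<gamma> ^ (\<sigma> * b))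
          = ((d ^ (3 * s ^ 3)) \<cdot>\<^sub>m F) $$ (i, j)"
      proof -
        have "real \<sigma> * w * x j = real (\<sigma> * a) * w + real (\<sigma> * b) * (\<beta> * w)"
          by (simp add: xj algebra_simps)
        then have "exp (real \<sigma> * w * x j) = \<alpha> ^ (\<sigma> * a) * \<gamma> ^ (\<sigma> * b)"
          by (simp only: exp_add exp_of_nat_mult w)
        moreover have "d ^ (3 * s ^ 3) = d ^ s ^ 3 * d ^ s ^ 3 * d ^ s ^ 3"
          by (simp only: mult.commute[of 3] power_mult power3_eq_cube)
        ultimately show ?thesis using ij F by (simp add: F_def t_def[symmetric] \<sigma>_def[symmetric] mult_ac)
      qed
      ultimately show "height_le n v (((d ^ (3 * s ^ 3)) \<cdot>\<^sub>m F) $$ (i, j)) ((2 * (real s)\<^sup>2 * K ^ 3) ^ s ^ 3)"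
        by simp
    qed (simp add: F)
    from C(2)[OF this nz]
    have "1 \<le> C * (fact L * ((2 * (real s)\<^sup>2 * K ^ 3) ^ s ^ 3) ^ L) ^ (n - 1) * ((d ^ (3 * s ^ 3)) ^ L * \<bar>det F\<bar>)"
      using F d by (simp add: abs_mult)
    also have "\<dots> \<le> C * (fact L * ((2 * (real s)\<^sup>2 * K ^ 3) ^ s ^ 3) ^ L) ^ (n - 1) * ((K ^ (3 * s ^ 3)) ^ L * (fact L * (X ^ s ^ 3 * exp (real s * \<bar>w\<bar> * X)) ^ L * ((c / real s) ^ (\<Sum>m<L. m) * exp (real L * real L))))"
    proof (intro mult_left_mono mult_mono power_mono)
      \<comment> \<open>The base of the powers in the upper bound is of order \<open>s ^ 3\<close>, smaller than \<open>L = s ^ 4\<close>.\<close>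
      have Q: "2 * X * (real (s ^ 3) / X + real s * \<bar>w\<bar>) = c * real s ^ 3"
        using s c\<^sub>1 by (simp add: c_def X_def field_simps power2_eq_square power3_eq_cube)
      have "\<bar>det F\<bar> \<le> fact L * (X ^ s ^ 3 * exp (real s * \<bar>w\<bar> * X)) ^ L * (\<Prod>m<L. (c * real s ^ 3) ^ m / fact m)"
        using abs_exp_monom_det_le[of s X x "s ^ 3" w] s X inj xX unfolding Q L F_def by simp
      also have "(\<Prod>m<L. (c * real s ^ 3) ^ m / fact m) \<le> (c * real s ^ 3 / real L) ^ (\<Sum>m<L. m) * exp (real L * real L)"
        using prod_power_div_fact_le[of "c * real s ^ 3" "real L" L] c s by (simp add: L)
      also have "c * real s ^ 3 / real L = c / real s" using s by (simp add: L)
      finally show "\<bar>det F\<bar> \<le> fact L * (X ^ s ^ 3 * exp (real s * \<bar>w\<bar> * X)) ^ L * ((c / real s) ^ (\<Sum>m<L. m) * exp (real L * real L))"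
        using X by (simp add: mult_left_mono)
    qed (use C(1) K d in auto)
    finally show ?thesis by (simp add: X_def)
  qed
  obtain s :: nat where s: "s > 0" and neg:
    "ln C + real (4 * (n - 1) + 4) * real s ^ 4 * ln (real s) + real (2 * (n - 1) + 2) * real s ^ 7 * ln (real s)
      + (real (n - 1) * ln (2 * K ^ 3) + 3 * ln K + ln c\<^sub>1 + \<bar>w\<bar> * c\<^sub>1) * real s ^ 7 + real s ^ 8
      + (real s ^ 4 * (real s ^ 4 - 1)) / 2 * (ln c - ln (real s)) < 0"
    using dominant_term_negative[of "ln C" "real (4 * (n - 1) + 4)" "real (2 * (n - 1) + 2)"
        "real (n - 1) * ln (2 * K ^ 3) + 3 * ln K + ln c\<^sub>1 + \<bar>w\<bar> * c\<^sub>1" "ln c"] by blast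
  define L where "L = s * s ^ 3"
  have L: "real L = real s ^ 4" by (simp add: L_def power_numeral_reduce)
  have "1 \<le> C * (fact L * ((2 * (real s)\<^sup>2 * K ^ 3) ^ s ^ 3) ^ L) ^ (n - 1) * ((K ^ (3 * s ^ 3)) ^ L *
      (fact L * (((real s)\<^sup>2 * c\<^sub>1) ^ s ^ 3 * exp (real s * \<bar>w\<bar> * ((real s)\<^sup>2 * c\<^sub>1))) ^ L * ((c / real s) ^ (\<Sum>m<L. m) * exp (real L * real L))))"
    by (rule key[OF s L_def])
  then have "0 \<le> ln (C * (fact L * ((2 * (real s)\<^sup>2 * K ^ 3) ^ s ^ 3) ^ L) ^ (n - 1) * ((K ^ (3 * s ^ 3)) ^ L *
      (fact L * (((real s)\<^sup>2 * c\<^sub>1) ^ s ^ 3 * exp (real s * \<bar>w\<bar> * ((real s)\<^sup>2 * c\<^sub>1))) ^ L * ((c / real s) ^ (\<Sum>m<L. m) * exp (real L * real L)))))"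
    by simp
  also have "\<dots> = ln C + real (n - 1) * (ln (fact L) + real L * (real s ^ 3 * (ln (2 * K ^ 3) + 2 * ln (real s))))
      + real L * (3 * real s ^ 3 * ln K) + ln (fact L) + real L * (real s ^ 3 * (2 * ln (real s) + ln c\<^sub>1) + real s * \<bar>w\<bar> * ((real s)\<^sup>2 * c\<^sub>1))
      + real (\<Sum>m<L. m) * (ln c - ln (real s)) + real L * real L"
    using C(1) K c c\<^sub>1 s by (simp add: ln_mult ln_div ln_realpow algebra_simps)
  also have "\<dots> \<le> ln C + real (n - 1) * (real L * (4 * ln (real s)) + real L * (real s ^ 3 * (ln (2 * K ^ 3) + 2 * ln (real s))))
      + real L * (3 * real s ^ 3 * ln K) + real L * (4 * ln (real s)) + real L * (real s ^ 3 * (2 * ln (real s) + ln c\<^sub>1) + real s * \<bar>w\<bar> * ((real s)\<^sup>2 * c\<^sub>1))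
      + real (\<Sum>m<L. m) * (ln c - ln (real s)) + real L * real L"
  proof -
    have "(fact L :: real) \<le> real L ^ L"
      using fact_le_power[of L, where 'a = real] by simp
    then have "ln (fact L) \<le> ln (real L ^ L)" by (subst ln_le_cancel_iff) (auto simp: L_def s)
    also have "\<dots> = real L * (4 * ln (real s))" using s by (simp add: ln_realpow L)
    finally show ?thesis by (intro order.refl add_mono mult_left_mono) auto
  qed
  also have "real (\<Sum>m<L. m) = (real s ^ 4 * (real s ^ 4 - 1)) / 2"
  proof -
    have "2 * (\<Sum>m<k. real m) = real k * (real k - 1)" for k
      by (induction k) (simp_all add: algebra_simps)
    from this[of L] show ?thesis by (simp add: L)
  qed
  finally have bound: "0 \<le> ln C + real (n - 1) * (real L * (4 * ln (real s)) + real L * (real s ^ 3 * (ln (2 * K ^ 3) + 2 * ln (real s))))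
      + real L * (3 * real s ^ 3 * ln K) + real L * (4 * ln (real s)) + real L * (real s ^ 3 * (2 * ln (real s) + ln c\<^sub>1) + real s * \<bar>w\<bar> * ((real s)\<^sup>2 * c\<^sub>1))
      + (real s ^ 4 * (real s ^ 4 - 1)) / 2 * (ln c - ln (real s)) + real L * real L" .
  have collect: "a + p * (u ^ 4 * (4 * l) + u ^ 4 * (u ^ 3 * (k + 2 * l))) + u ^ 4 * (3 * u ^ 3 * b)
        + u ^ 4 * (4 * l) + u ^ 4 * (u ^ 3 * (2 * l + e) + u * h * (u\<^sup>2 * c\<^sub>1)) + g + u ^ 4 * u ^ 4
      = a + (4 * p + 4) * u ^ 4 * l + (2 * p + 2) * u ^ 7 * l + (p * k + 3 * b + e + h * c\<^sub>1) * u ^ 7 + u ^ 8 + g"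
    for a p u l k b e h g :: real
    by (simp add: power_numeral_reduce algebra_simps)
  show False
    using bound neg unfolding L collect by (simp add: add.commute)
qed

theorem theorem2:
  fixes q z :: real
  assumes "algebraic q" and "q \<notin> \<rat>"
    and "algebraic z" and "z \<noteq> 0"
    and "1 + (1 - q) * z > 0"
  shows "\<not> algebraic (tsallis_exp q z)"
proof -
  have q: "q \<noteq> 1" using assms(2) by auto
  have alg: "algebraic (1 - q)"
    using algebraic_add[of 1 "- q"] assms(1) by simp
  then have base: "algebraic (1 + (1 - q) * z)" "1 + (1 - q) * z \<noteq> 1"
    using assms(3,4) q by (auto intro!: algebraic_add algebraic_mult)
  have "1 / (1 - q) \<notin> \<rat>"
  proof
    assume "1 / (1 - q) \<in> \<rat>"
    then have "1 - inverse (1 / (1 - q)) \<in> \<rat>" by (intro Rats_diff Rats_inverse Rats_1)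
    moreover have "1 - inverse (1 / (1 - q)) = q" by simp
    ultimately show False using assms(2) by metis
  qed
  then have "\<not> algebraic ((1 + (1 - q) * z) powr (1 / (1 - q)))"
    using alg base assms(5)
    by (intro gelfond_schneider_real) (auto simp: inverse_eq_divide[symmetric])
  then show ?thesis using q assms(5) by (simp add: tsallis_exp_def)
qed

end
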